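(* Let $d\geq 1$, let $A\subseteq\mathbb{Z}$ be a finite alphabet, let $X\subseteq A^{\mathbb{Z}^d}$ be a subshift and let $S$ be a proper linear subspace of $\mathbb{R}^d$. If $f\in\mathrm{Per}(X)$ satisfies $\mathrm{Supp}(f)\cap S=\{\vec{0}\}$, then there exist pairwise linearly independent $\vec{t}_1,\dots,\vec{t}_m\in\mathbb{Z}^d$ such that $\vec{t}_i\notin S$ for all $i\in\{1,\dots,m\}$ and $(\vec{x}^{\vec{t}_1}-1)\cdots(\vec{x}^{\vec{t}_m}-1)\in\mathrm{Ann}(X)$. In particular, if $S$ is $(d-1)$-dimensional then $S$ is an expansive space for $X$.
   Context: A configuration is a map $c:\mathbb{Z}^d\to A$; write $c_{\vec{u}}$ for its value at $\vec{u}$. The translation $\tau^{\vec{t}}$ is defined by $\tau^{\vec{t}}(c)_{\vec{u}}=c_{\vec{u}+\vec{t}}$. A configuration is strongly periodic if $\tau^{\vec{t}}(c)=c$ for $d$ linearly independent vectors $\vec{t}\in\mathbb{Z}^d$. A subshift is a subset of $A^{\mathbb{Z}^d}$ (possibly empty) that is closed in the prodiscrete (product) topology and invariant under all translations. A configuration is identified with the formal power series $c(\vec{x})=\sum_{\vec{u}\in\mathbb{Z}^d}c_{\vec{u}}\vec{x}^{\vec{u}}$, where $\vec{x}^{\vec{u}}=x_1^{u_1}\cdots x_d^{u_d}$; for a Laurent polynomial $f\in\mathbb{C}[x_1^{\pm1},\dots,x_d^{\pm1}]$ with coefficients $f_{\vec{v}}$, the product $fc$ is the formal series with $(fc)_{\vec{u}}=\sum_{\vec{v}}f_{\vec{v}}c_{\vec{u}-\vec{v}}$,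 and $\mathrm{Supp}(f)=\{\vec{v}\in\mathbb{Z}^d: f_{\vec{v}}\neq0\}$. $\mathrm{Ann}(X)$ is the set of complex Laurent polynomials $f$ with $fc=0$ for all $c\in X$; $\mathrm{Per}(X)$ is the set of complex Laurent polynomials $f$ such that $fc$ is strongly periodic for every $c\in X$. For a nonzero $\vec{u}\in\mathbb{R}^d$ let $H_{\vec{u}}=\{\vec{x}\in\mathbb{Z}^d: \langle\vec{x},\vec{u}\rangle<0\}$. $X$ is deterministic in the direction $\vec{u}$ if for all $c,c'\in X$, $c|_{H_{\vec{u}}}=c'|_{H_{\vec{u}}}$ implies $c=c'$. A $(d-1)$-dimensional subspace $S=\{\vec{v}:\langle\vec{u},\vec{v}\rangle=0\}$ (with $\vec{u}\neq\vec{0}$) is an expansive space for $X$ if $X$ is deterministic in both directions $\vec{u}$ and $-\vec{u}$. *)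

theory Defs
  imports "HOL-Analysis.Analysis" "HOL-Library.Poly_Mapping"
begin

text \<open>
  A Laurent polynomial in \<open>x\<^sub>1, \<dots>, x\<^sub>d\<close> is a finitely supported map from exponent vectors in
  \<open>int ^ 'd\<close> to coefficients; the convolution product of \<^theory>\<open>HOL-Library.Poly_Mapping\<close>
  is then the usual multiplication, and \<^const>\<open>Poly_Mapping.keys\<close> is the support.
\<close>

type_synonym 'd laurent = "(int ^ 'd) \<Rightarrow>\<^sub>0 complex"

definition laurent_monom :: "int ^ 'd \<Rightarrow> 'd laurent" where
  "laurent_monom t = Poly_Mapping.single t 1"

definition real_vec :: "int ^ 'd \<Rightarrow> real ^ 'd" where
  "real_vec t = (\<chi> i. real_of_int (t $ i))"

definition translate :: "int ^ 'd \<Rightarrow> (int ^ 'd \<Rightarrow> 'a) \<Rightarrow> (int ^ 'd \<Rightarrow> 'a)" where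
  "translate t c = (\<lambda>u. c (u + t))"

text \<open>The map \<^const>\<open>real_vec\<close> is injective, so \<open>T\<close> and its image have the same cardinality.\<close>

definition strongly_periodic :: "(int ^ 'd \<Rightarrow> 'a) \<Rightarrow> bool" where
  "strongly_periodic c \<longleftrightarrow>
     (\<exists>T. finite T \<and> card T = CARD('d) \<and> independent (real_vec ` T) \<and>
          (\<forall>t\<in>T. translate t c = c))"

text \<open>
  Being closed in the product topology includes being a subset of its underlying space,
  which is the set of all maps from \<open>int ^ 'd\<close> to \<open>A\<close>.
\<close>

definition subshift :: "int set \<Rightarrow> (int ^ 'd \<Rightarrow> int) set \<Rightarrow> bool" where
  "subshift A X \<longleftrightarrow>
     closedin (product_topology (\<lambda>_. discrete_topology A) UNIV) X \<and>
     (\<forall>t. \<forall>c\<in>X. translate t c \<in> X)"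

definition series_mult :: "'d laurent \<Rightarrow> (int ^ 'd \<Rightarrow> complex) \<Rightarrow> (int ^ 'd \<Rightarrow> complex)" where
  "series_mult f c = (\<lambda>u. \<Sum>v\<in>Poly_Mapping.keys f. Poly_Mapping.lookup f v * c (u - v))"

definition config_series :: "(int ^ 'd \<Rightarrow> int) \<Rightarrow> (int ^ 'd \<Rightarrow> complex)" where
  "config_series c = (\<lambda>u. of_int (c u))"

definition Ann :: "(int ^ 'd \<Rightarrow> int) set \<Rightarrow> 'd laurent set" where
  "Ann X = {f. \<forall>c\<in>X. series_mult f (config_series c) = (\<lambda>_. 0)}"

definition Per :: "(int ^ 'd \<Rightarrow> int) set \<Rightarrow> 'd laurent set" where
  "Per X = {f. \<forall>c\<in>X. strongly_periodic (series_mult f (config_series c))}"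

definition lattice_halfspace :: "real ^ 'd \<Rightarrow> (int ^ 'd) set" where
  "lattice_halfspace u = {x. real_vec x \<bullet> u < 0}"

definition deterministic :: "(int ^ 'd \<Rightarrow> 'a) set \<Rightarrow> real ^ 'd \<Rightarrow> bool" where
  "deterministic X u \<longleftrightarrow>
     (\<forall>c\<in>X. \<forall>c'\<in>X. (\<forall>x\<in>lattice_halfspace u. c x = c' x) \<longrightarrow> c = c')"

text \<open>
  The normal vector of a hyperplane is unique up to a nonzero factor, and \<open>lattice_halfspace u\<close>
  is unchanged when \<open>u\<close> is scaled by a positive number, so the choice of \<open>u\<close> does not matter.
\<close>

definition expansive_space :: "(int ^ 'd \<Rightarrow> 'a) set \<Rightarrow> (real ^ 'd) set \<Rightarrow> bool" where
  "expansive_space X S \<longleftrightarrow>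
     (\<exists>u. u \<noteq> 0 \<and> S = {v. u \<bullet> v = 0} \<and> deterministic X u \<and> deterministic X (- u))"

text \<open>
  The inequality is needed: linear independence of the pair \<open>s, t\<close> must fail when \<open>s = t\<close>,
  although the set \<open>{s, t}\<close> is then a singleton.
\<close>

definition lin_indep_pair :: "int ^ 'd \<Rightarrow> int ^ 'd \<Rightarrow> bool" where
  "lin_indep_pair s t \<longleftrightarrow> s \<noteq> t \<and> independent {real_vec s, real_vec t}"

end

theory Submission
  imports Defs
begin

text \<open>
  By compactness, a subshift all of whose points are strongly periodic is finite; hence the
  configurations \<open>fc\<close>, \<open>c \<in> X\<close>, have a common period, and multiplying \<open>f\<close> by \<open>x\<^sup>t - 1\<close> for a suitable
  period \<open>t \<notin> S\<close> gives an annihilator whose support still meets \<open>S\<close> only in 0. A \<open>\<rat>\<close>-linear functional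
  makes its coefficients integers. Modulo a prime \<open>p\<close> one has \<open>g\<^sup>p = g(x\<^sup>p)\<close>, and configurations are bounded,
  so \<open>g(x\<^sup>k)\<close> annihilates \<open>X\<close> whenever \<open>k\<close> has only large prime factors, in particular for all
  \<open>k = 1 + ir\<close> with a suitable \<open>r\<close>. Eliminating between these relations leaves
  \<open>\<Prod>\<^sub>v (x\<^bsup>rv\<^esup> - 1)\<close>, where \<open>v\<close> ranges over the nonzero elements of the support. Boundedness also makes
  the annihilator insensitive to multiplicities, so that parallel factors can be merged.
  A configuration that vanishes on one side of \<open>S\<close> and is killed by \<open>x\<^sup>t - 1\<close> with \<open>t \<notin> S\<close> is 0, since
  its period \<open>t\<close> moves every point into that side.
\<close>

subsection \<open>The action of Laurent polynomials on configurations\<close>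

text \<open>The coefficient ring stays general because the same action is needed over the complex
  numbers and, for congruences modulo a prime, over the integers.\<close>

definition poly_act ::
    "('g::ab_group_add \<Rightarrow>\<^sub>0 'r::comm_ring_1) \<Rightarrow> ('g \<Rightarrow> 'r) \<Rightarrow> 'g \<Rightarrow> 'r" where
  "poly_act f c u = (\<Sum>v\<in>Poly_Mapping.keys f. Poly_Mapping.lookup f v * c (u - v))"

lemma series_mult_eq_poly_act: "series_mult = poly_act"
  by (intro ext) (simp add: series_mult_def poly_act_def)

lemma poly_act_superset:
  assumes "finite V" "Poly_Mapping.keys f \<subseteq> V"
  shows "poly_act f c u = (\<Sum>v\<in>V. Poly_Mapping.lookup f v * c (u - v))"
  unfolding poly_act_def
  by (rule sum.mono_neutral_left) (use assms in \<open>auto simp: in_keys_iff\<close>)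

lemma poly_act_0 [simp]: "poly_act 0 c = (\<lambda>_. 0)"
  by (simp add: poly_act_def fun_eq_iff)

lemma poly_act_zero_right [simp]: "poly_act f (\<lambda>_. 0) = (\<lambda>_. 0)"
  by (simp add: poly_act_def fun_eq_iff)

lemma poly_act_add: "poly_act (f + g) c u = poly_act f c u + poly_act g c u"
proof -
  let ?V = "Poly_Mapping.keys f \<union> Poly_Mapping.keys g"
  have *: "finite ?V" "Poly_Mapping.keys f \<subseteq> ?V" "Poly_Mapping.keys g \<subseteq> ?V"
    "Poly_Mapping.keys (f + g) \<subseteq> ?V"
    using keys_add[of f g] by auto
  show ?thesis
    unfolding poly_act_superset[OF *(1,2)] poly_act_superset[OF *(1,3)] poly_act_superset[OF *(1,4)]
    by (simp add: lookup_add algebra_simps sum.distrib)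
qed

lemma poly_act_single: "poly_act (Poly_Mapping.single t a) c u = a * c (u - t)"
  by (subst poly_act_superset[of "{t}"]) auto

lemma poly_act_sum: "poly_act (\<Sum>i\<in>I. f i) c u = (\<Sum>i\<in>I. poly_act (f i) c u)"
  by (induction I rule: infinite_finite_induct) (auto simp: poly_act_add)

lemma poly_mapping_eq_sum_single:
  "f = (\<Sum>v\<in>Poly_Mapping.keys f. Poly_Mapping.single v (Poly_Mapping.lookup f v))"
  by (intro poly_mapping_eqI)
    (auto simp: lookup_sum lookup_single when_def in_keys_iff sum.delta' split: if_splits)

text \<open>Expanding both factors into monomials reduces this to composing shifts. The
  configurations thus form a module over the Laurent polynomials, which makes \<open>Ann X\<close>
  an ideal.\<close>

lemma poly_act_mult: "poly_act (f * g) c = poly_act f (poly_act g c)"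
proof
  fix u
  let ?s = "\<lambda>f v. Poly_Mapping.single v (Poly_Mapping.lookup f v)"
  have "f * g = (\<Sum>v\<in>Poly_Mapping.keys f. \<Sum>w\<in>Poly_Mapping.keys g. ?s f v * ?s g w)"
    by (subst poly_mapping_eq_sum_single[of f], subst poly_mapping_eq_sum_single[of g])
      (simp add: sum_product)
  then show "poly_act (f * g) c u = poly_act f (poly_act g c) u"
    by (simp add: poly_act_sum mult_single poly_act_single)
      (simp add: poly_act_def sum_distrib_left algebra_simps)
qed

lemma poly_act_minus: "poly_act (f - g) c u = poly_act f c u - poly_act g c u"
  using poly_act_add[of "f - g" g c u] by simp

lemma poly_act_1 [simp]: "poly_act 1 c = c"
  by (intro ext) (simp add: poly_act_single flip: single_one)

lemma poly_act_monom_minus_1: "poly_act (laurent_monom t - 1) c u = c (u - t) - c u"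
  by (simp add: poly_act_minus laurent_monom_def poly_act_single)

lemma in_Ann_iff: "f \<in> Ann X \<longleftrightarrow> (\<forall>c\<in>X. poly_act f (config_series c) = (\<lambda>_. 0))"
  by (simp add: Ann_def series_mult_eq_poly_act)

lemma Ann_mult: "f \<in> Ann X \<Longrightarrow> g * f \<in> Ann X"
  by (simp add: in_Ann_iff poly_act_mult)

lemma Ann_dvd: "f \<in> Ann X \<Longrightarrow> f dvd g \<Longrightarrow> g \<in> Ann X"
  by (metis Ann_mult dvd_def mult.commute)

lemma Ann_diff: "f \<in> Ann X \<Longrightarrow> g \<in> Ann X \<Longrightarrow> f - g \<in> Ann X"
  by (simp add: in_Ann_iff fun_eq_iff poly_act_minus)

subsection \<open>Dilating annihilators by large primes\<close>

text \<open>Only the two end terms of the binomial expansion survive: \<open>p\<close> divides every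
  \<open>p choose k\<close> with \<open>0 < k < p\<close>.\<close>

lemma prime_dvd_power_add:
  fixes a b :: "'r::comm_ring_1"
  assumes "prime p"
  shows "of_nat p dvd (a + b) ^ p - (a ^ p + b ^ p)"
proof -
  have "p > 0" using assms by (simp add: prime_gt_0_nat)
  have "{..p} = insert 0 (insert p {1..<p})" using \<open>p > 0\<close> by auto
  then have "(a + b) ^ p - (a ^ p + b ^ p) = (\<Sum>k\<in>{1..<p}. of_nat (p choose k) * a ^ k * b ^ (p - k))"
    using \<open>p > 0\<close> by (simp add: binomial_ring algebra_simps)
  moreover have "of_nat p dvd (of_nat (p choose k) * a ^ k * b ^ (p - k) :: 'r)" if "k \<in> {1..<p}" for k
  proof -
    have "p dvd (p choose k)" using that assms by (intro dvd_choose_prime) auto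
    then obtain q where "(p choose k) = p * q" ..
    then show ?thesis by (simp add: mult.assoc)
  qed
  ultimately show ?thesis by (metis (no_types, lifting) dvd_sum)
qed

lemma prime_dvd_power_sum:
  fixes a :: "'i \<Rightarrow> 'r::comm_ring_1"
  assumes "prime p"
  shows "of_nat p dvd (\<Sum>i\<in>I. a i) ^ p - (\<Sum>i\<in>I. a i ^ p)"
proof (induction I rule: infinite_finite_induct)
  case (insert x F)
  have "of_nat p dvd ((a x + sum a F) ^ p - (a x ^ p + sum a F ^ p)) + (sum a F ^ p - (\<Sum>i\<in>F. a i ^ p))"
    by (intro dvd_add insert prime_dvd_power_add assms)
  then show ?case using insert by (simp add: algebra_simps)
qed (use prime_gt_0_nat[OF assms] in \<open>auto simp: zero_power\<close>)

text \<open>Fermat's little theorem: the preceding congruence for a sum of \<open>n\<close> ones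
  settles natural numbers, and reduction modulo \<open>p\<close> leads every integer back to
  these.\<close>

lemma prime_dvd_int_power_diff:
  fixes a :: int
  assumes "prime p"
  shows "int p dvd a ^ p - a"
proof -
  have *: "int p dvd (int n) ^ p - int n" for n
    using prime_dvd_power_sum[OF assms, of "\<lambda>_. 1::int" "{..<n}"] by simp
  have "a ^ p mod int p = (a mod int p) ^ p mod int p" by (simp add: power_mod)
  also have "\<dots> = (a mod int p) mod int p"
    using *[of "nat (a mod int p)"] assms
    by (simp add: prime_gt_0_nat flip: mod_eq_dvd_iff)
  finally show ?thesis by (simp flip: mod_eq_dvd_iff)
qed

lemma int_dvd_poly_act_if_of_nat_dvd:
  fixes h :: "'g::ab_group_add \<Rightarrow>\<^sub>0 int"
  assumes "of_nat p dvd h"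
  shows "int p dvd poly_act h c u"
proof -
  obtain k where "h = of_nat p * k" using assms by (auto simp: dvd_def)
  then have "poly_act h c u = int p * poly_act k c u"
    by (simp add: poly_act_mult poly_act_single flip: single_of_nat)
  then show ?thesis by simp
qed

lemma single_power:
  "Poly_Mapping.single (e :: int ^ 'd) a ^ n = Poly_Mapping.single (of_nat n * e) (a ^ n)"
  by (induction n) (auto simp: mult_single algebra_simps)

text \<open>Modulo \<open>p\<close>, the power \<open>g ^ p\<close> has the exponents of
  \<open>g\<close> multiplied by \<open>p\<close> and, by Fermat, the same coefficients, so the
  dilated sum is divisible by \<open>p\<close>. By \<open>large\<close> it is too small to be a
  nonzero multiple. The exponents form a family \<open>e\<close> so that an already dilated relation
  can be dilated again.\<close>

lemma annihilator_dilate_prime: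
  fixes c :: "int ^ 'd \<Rightarrow> int" and a :: "'i \<Rightarrow> int"
  assumes ann: "\<And>u. (\<Sum>v\<in>V. a v * c (u - e v)) = 0"
    and bound: "\<And>u. \<bar>c u\<bar> \<le> B"
    and p: "prime p" and large: "(\<Sum>v\<in>V. \<bar>a v\<bar>) * B < int p"
  shows "(\<Sum>v\<in>V. a v * c (u - of_nat p * e v)) = 0"
proof -
  let ?S = "\<lambda>p. \<Sum>v\<in>V. Poly_Mapping.single (of_nat p * e v) (a v)"
  define g where "g = (\<Sum>v\<in>V. Poly_Mapping.single (e v) (a v))"
  have g0: "poly_act g c = (\<lambda>_. 0)"
    using ann by (auto simp: g_def poly_act_sum poly_act_single)
  have "p \<noteq> 0" using p by auto
  then have "g ^ p = g ^ (p - 1) * g" by (metis power_minus_mult gr0I)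
  then have gp: "poly_act (g ^ p) c u = 0"
    by (simp add: poly_act_mult g0)
  have "of_nat p dvd g ^ p - (\<Sum>v\<in>V. Poly_Mapping.single (e v) (a v) ^ p)"
    unfolding g_def by (rule prime_dvd_power_sum[OF p])
  then have 1: "int p dvd poly_act (g ^ p) c u
      - (\<Sum>v\<in>V. a v ^ p * c (u - of_nat p * e v))"
    by (drule_tac int_dvd_poly_act_if_of_nat_dvd[where c = c and u = u])
      (simp add: poly_act_minus poly_act_sum single_power poly_act_single)
  have 2: "int p dvd (\<Sum>v\<in>V. (a v ^ p - a v) * c (u - of_nat p * e v))"
    by (intro dvd_sum dvd_mult2 prime_dvd_int_power_diff p)
  let ?s = "\<Sum>v\<in>V. a v * c (u - of_nat p * e v)"
  have "int p dvd (\<Sum>v\<in>V. a v ^ p * c (u - of_nat p * e v))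
      - (\<Sum>v\<in>V. (a v ^ p - a v) * c (u - of_nat p * e v))"
    using 1 2 gp by (intro dvd_diff) auto
  then have "int p dvd ?s"
    by (simp add: algebra_simps sum_subtractf)
  moreover have "\<bar>?s\<bar> < int p"
  proof -
    have "\<bar>?s\<bar> \<le> (\<Sum>v\<in>V. \<bar>a v\<bar> * B)"
      by (intro sum_abs[THEN order_trans] sum_mono) (auto simp: abs_mult intro!: mult_left_mono bound)
    also have "\<dots> < int p" using large by (simp add: sum_distrib_right)
    finally show ?thesis .
  qed
  ultimately show ?thesis
    using zdvd_not_zless[of "\<bar>?s\<bar>" "int p"] by (cases "?s = 0") auto
qed

text \<open>One prime factor of \<open>k\<close> is split off at a time. Dilation leaves the
  coefficients alone, so the same size condition on primes serves at every stage.\<close>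

lemma annihilator_dilate:
  fixes c :: "int ^ 'd \<Rightarrow> int" and a :: "'i \<Rightarrow> int"
  assumes ann: "\<And>u. (\<Sum>v\<in>V. a v * c (u - e v)) = 0"
    and bound: "\<And>u. \<bar>c u\<bar> \<le> B"
    and large: "\<And>p. prime p \<Longrightarrow> p dvd k \<Longrightarrow> (\<Sum>v\<in>V. \<bar>a v\<bar>) * B < int p"
    and "k > 0"
  shows "(\<Sum>v\<in>V. a v * c (u - of_nat k * e v)) = 0"
  using large \<open>k > 0\<close>
proof (induction k arbitrary: u rule: less_induct)
  case (less k)
  show ?case
  proof (cases "k = 1")
    case False
    then obtain p where p: "prime p" "p dvd k" using prime_factor_nat by blast
    then obtain l where l: "k = p * l" by auto
    then have "l > 0" "l < k" using p less.prems prime_gt_1_nat[of p] by auto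
    then have "(\<Sum>v\<in>V. a v * c (u - of_nat l * e v)) = 0" for u
      using less l by simp
    from annihilator_dilate_prime[OF this bound p(1) less.prems(1)[OF p]]
    show ?thesis by (simp add: l mult.assoc)
  qed (simp add: ann)
qed

text \<open>For \<open>r = fact M\<close>, no prime up to \<open>M\<close> divides
  \<open>1 + i * r\<close>. An arithmetic progression of dilation factors is wanted because the
  terms of the resulting relations are geometric in \<open>i\<close>.\<close>

lemma annihilator_dilate_progression:
  fixes X :: "(int ^ 'd \<Rightarrow> int) set" and a :: "'i \<Rightarrow> int"
  assumes ann: "\<And>c u. c \<in> X \<Longrightarrow> (\<Sum>v\<in>V. a v * c (u - e v)) = 0"
    and bound: "\<And>c u. c \<in> X \<Longrightarrow> \<bar>c u\<bar> \<le> B"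
  obtains r :: nat where "r > 0"
    "\<And>i c u. c \<in> X \<Longrightarrow> (\<Sum>v\<in>V. a v * c (u - of_nat (1 + i * r) * e v)) = 0"
proof -
  define M where "M = nat ((\<Sum>v\<in>V. \<bar>a v\<bar>) * B)"
  have "(\<Sum>v\<in>V. a v * c (u - of_nat (1 + i * fact M) * e v)) = 0" if "c \<in> X" for i c u
  proof (rule annihilator_dilate[where B = B])
    fix p :: nat assume p: "prime p" "p dvd 1 + i * fact M"
    have "\<not> p \<le> M"
    proof
      assume "p \<le> M"
      then have "p dvd fact M" using p prime_ge_1_nat dvd_fact by blast
      then have "p dvd i * fact M" by (rule dvd_mult)
      then have "p dvd 1" using p(2) dvd_add_left_iff by blast
      then show False using p(1) by simp
    qed
    then show "(\<Sum>v\<in>V. \<bar>a v\<bar>) * B < int p" by (auto simp: M_def)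
  qed (use that ann bound in auto)
  then show ?thesis using that[of "fact M"] by simp
qed

text \<open>Vandermonde elimination: only ring operations are used, so no Nullstellensatz is needed.\<close>

lemma Ann_eliminate:
  fixes a y :: "'i \<Rightarrow> 'd::finite laurent"
  assumes "finite W" and "\<And>i. (\<Sum>v\<in>V. a v * y v ^ i) \<in> Ann X"
  shows "(\<Sum>v\<in>V. a v * (\<Prod>w\<in>W. y v - y w) * y v ^ i) \<in> Ann X"
  using \<open>finite W\<close>
proof (induction W arbitrary: i rule: finite_induct)
  case (insert w W)
  \<comment> \<open>Subtracting \<open>y w\<close> times the relation for \<open>i\<close> from the
    one for \<open>Suc i\<close> multiplies the term at \<open>v\<close> by
    \<open>y v - y w\<close>, and so removes the term at \<open>w\<close>.\<close>
  have "(\<Sum>v\<in>V. a v * (\<Prod>w\<in>W. y v - y w) * y v ^ Suc i)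
      - y w * (\<Sum>v\<in>V. a v * (\<Prod>w\<in>W. y v - y w) * y v ^ i) \<in> Ann X"
    by (intro Ann_diff Ann_mult insert.IH)
  also have "(\<Sum>v\<in>V. a v * (\<Prod>w\<in>W. y v - y w) * y v ^ Suc i)
      - y w * (\<Sum>v\<in>V. a v * (\<Prod>w\<in>W. y v - y w) * y v ^ i)
      = (\<Sum>v\<in>V. a v * (\<Prod>w\<in>insert w W. y v - y w) * y v ^ i)"
    using insert by (simp add: sum_distrib_left algebra_simps flip: sum_subtractf)
  finally show ?case .
qed (use assms in simp)

subsection \<open>Lattices of periods\<close>

lemma of_int_index_vec: "(of_int n :: int ^ 'd) $ i = n"
  by (cases n rule: int_diff_cases) (simp add: of_nat_index)

lemma finite_vec_box: "finite {x :: int ^ 'd. \<forall>i. x $ i \<in> F i}" if "\<And>i. finite (F i)"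
proof -
  have "finite (Pi\<^sub>E UNIV F)" using that by (intro finite_PiE) auto
  then have "finite (vec_lambda ` Pi\<^sub>E UNIV F)" by (rule finite_imageI)
  moreover have "{x :: int ^ 'd. \<forall>i. x $ i \<in> F i} \<subseteq> vec_lambda ` Pi\<^sub>E UNIV F"
    by (auto intro!: image_eqI[of _ _ "vec_nth _"])
  ultimately show ?thesis by (rule rev_finite_subset)
qed

lemma real_vec_add: "real_vec (s + t) = real_vec s + real_vec t"
  and real_vec_diff: "real_vec (s - t) = real_vec s - real_vec t"
  and real_vec_0: "real_vec 0 = 0"
  and real_vec_of_int_mult: "real_vec (of_int n * t) = real_of_int n *\<^sub>R real_vec t"
  and real_vec_of_nat_mult: "real_vec (of_nat m * t) = real m *\<^sub>R real_vec t"
  by (simp_all add: real_vec_def vec_eq_iff of_int_index_vec of_nat_index)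

lemma inj_real_vec: "inj real_vec"
  by (rule injI) (simp add: real_vec_def vec_eq_iff)

lemma real_vec_eq_0_iff: "real_vec t = 0 \<longleftrightarrow> t = 0"
  by (metis inj_real_vec injD real_vec_0)

definition period_lattice :: "(int ^ 'd \<Rightarrow> 'a) \<Rightarrow> (int ^ 'd) set" where
  "period_lattice c = {t. \<forall>u. c (u + t) = c u}"

lemma period_lattice_0: "0 \<in> period_lattice c"
  by (simp add: period_lattice_def)

lemma period_lattice_add: "s \<in> period_lattice c \<Longrightarrow> t \<in> period_lattice c \<Longrightarrow> s + t \<in> period_lattice c"
  by (simp add: period_lattice_def flip: add.assoc)

lemma period_lattice_uminus: "t \<in> period_lattice c \<Longrightarrow> - t \<in> period_lattice c"
  unfolding period_lattice_def by (simp, metis diff_add_cancel diff_conv_add_uminus)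

lemma period_lattice_diff: "s \<in> period_lattice c \<Longrightarrow> t \<in> period_lattice c \<Longrightarrow> s - t \<in> period_lattice c"
  using period_lattice_add[OF _ period_lattice_uminus] by (metis diff_conv_add_uminus)

lemma period_lattice_of_nat_mult:
  "t \<in> period_lattice c \<Longrightarrow> of_nat n * t \<in> period_lattice c"
  by (induction n) (simp_all add: period_lattice_0 period_lattice_add distrib_right)

lemma period_lattice_of_int_mult:
  "t \<in> period_lattice c \<Longrightarrow> of_int n * t \<in> period_lattice c"
  by (cases n rule: int_diff_cases)
    (simp add: left_diff_distrib period_lattice_diff period_lattice_of_nat_mult)

lemma period_lattice_sum:
  "(\<And>i. i \<in> I \<Longrightarrow> t i \<in> period_lattice c) \<Longrightarrow> (\<Sum>i\<in>I. t i) \<in> period_lattice c"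
  by (induction I rule: infinite_finite_induct) (simp_all add: period_lattice_0 period_lattice_add)

text \<open>
  Reducing the multiples of \<open>w\<close> into a fundamental parallelepiped of the periods leaves
  finitely many integer vectors, so two multiples have the same remainder.
\<close>

lemma strongly_periodic_multiple:
  fixes c :: "int ^ 'd \<Rightarrow> 'a"
  assumes "strongly_periodic c"
  obtains n :: nat where "n > 0" "of_nat n * w \<in> period_lattice c"
proof -
  obtain T where T: "finite T" "card T = CARD('d)" "independent (real_vec ` T)"
    "\<And>t. t \<in> T \<Longrightarrow> t \<in> period_lattice c"
    using assms by (auto simp: strongly_periodic_def period_lattice_def translate_def fun_eq_iff)
  have "card (real_vec ` T) = DIM(real ^ 'd)"
    using T by (simp add: card_image inj_on_subset[OF inj_real_vec])
  then have "UNIV \<subseteq> span (real_vec ` T)"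
    using T(3) by (intro card_ge_dim_independent) auto
  then have "real_vec w \<in> span (real_vec ` T)" by blast
  then obtain \<alpha> where "real_vec w = (\<Sum>x\<in>real_vec ` T. \<alpha> x *\<^sub>R x)"
    using T(1) by (auto simp: span_finite)
  then have \<alpha>: "real_vec w = (\<Sum>t\<in>T. \<alpha> (real_vec t) *\<^sub>R real_vec t)"
    by (simp add: sum.reindex inj_on_subset[OF inj_real_vec])
  define \<rho> where "\<rho> n = of_nat n * w - (\<Sum>t\<in>T. of_int \<lfloor>real n * \<alpha> (real_vec t)\<rfloor> * t)" for n :: nat
  define B where "B i = (\<Sum>t\<in>T. \<bar>t $ i\<bar>)" for i
  have "\<rho> n $ i \<in> {- B i .. B i}" for n i
  proof -
    have sc: "real_of_int (w $ i) = (\<Sum>t\<in>T. \<alpha> (real_vec t) * real_of_int (t $ i))"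
      using arg_cong[OF \<alpha>, of "\<lambda>x. x $ i"] by (simp add: real_vec_def)
    have "real_of_int (\<rho> n $ i) = real n * real_of_int (w $ i)
        - (\<Sum>t\<in>T. of_int \<lfloor>real n * \<alpha> (real_vec t)\<rfloor> * real_of_int (t $ i))"
      by (simp add: \<rho>_def of_nat_index of_int_index_vec)
    also have "\<dots> = (\<Sum>t\<in>T. frac (real n * \<alpha> (real_vec t)) * real_of_int (t $ i))"
      by (simp add: sc frac_def sum_distrib_left sum_subtractf left_diff_distrib mult.assoc)
    also have "\<bar>\<dots>\<bar> \<le> (\<Sum>t\<in>T. 1 * \<bar>real_of_int (t $ i)\<bar>)"
      by (intro sum_abs[THEN order_trans] sum_mono)
        (auto simp: abs_mult intro!: mult_left_le_one_le less_imp_le[OF frac_lt_1])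
    finally have "\<bar>\<rho> n $ i\<bar> \<le> B i"
      unfolding B_def by (metis (mono_tags, lifting) mult_1 of_int_abs of_int_le_iff of_int_sum sum.cong)
    then show ?thesis by auto
  qed
  then have "range \<rho> \<subseteq> {x. \<forall>i. x $ i \<in> {- B i .. B i}}" by blast
  then have "finite (range \<rho>)"
    by (rule finite_subset) (rule finite_vec_box, simp)
  then have "\<not> inj \<rho>" using finite_imageD infinite_UNIV_nat by blast
  then obtain m n where "m < n" "\<rho> m = \<rho> n"
    by (metis injI linorder_neqE_nat)
  then have "of_nat n * w - of_nat m * w = (\<Sum>t\<in>T. of_int \<lfloor>real n * \<alpha> (real_vec t)\<rfloor> * t)
      - (\<Sum>t\<in>T. of_int \<lfloor>real m * \<alpha> (real_vec t)\<rfloor> * t)"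
    unfolding \<rho>_def by (simp add: algebra_simps)
  also have "\<dots> \<in> period_lattice c"
    by (intro period_lattice_diff period_lattice_sum period_lattice_of_int_mult T)
  finally have "of_nat (n - m) * w \<in> period_lattice c"
    using \<open>m < n\<close> by (simp add: of_nat_diff left_diff_distrib)
  then show ?thesis using that[of "n - m"] \<open>m < n\<close> by simp
qed

text \<open>Each axis vector has a positive multiple that is a period. The product of these
  multipliers serves all axes at once, hence all integer combinations.\<close>

lemma strongly_periodic_common_multiple:
  fixes c :: "int ^ 'd \<Rightarrow> 'a"
  assumes "strongly_periodic c"
  obtains k :: nat where "k > 0" "\<And>t. of_nat k * t \<in> period_lattice c"
proof -
  have "\<exists>n>0. of_nat n * axis i 1 \<in> period_lattice c" for i
    by (metis strongly_periodic_multiple[OF assms])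
  then obtain n :: "'d \<Rightarrow> nat" where n: "\<And>i. n i > 0" "\<And>i. of_nat (n i) * axis i 1 \<in> period_lattice c"
    by metis
  define k where "k = (\<Prod>i\<in>UNIV. n i)"
  have kn: "k = (\<Prod>j\<in>UNIV - {i}. n j) * n i" for i
    unfolding k_def by (subst prod.remove[of _ i]) auto
  have "of_nat k * t \<in> period_lattice c" for t
  proof -
    have "t = (\<Sum>i\<in>UNIV. of_int (t $ i) * axis i 1)"
      by (simp add: vec_eq_iff of_int_index_vec axis_def if_distrib sum.delta cong: if_cong)
    then have "of_nat k * t = (\<Sum>i\<in>UNIV. of_nat k * (of_int (t $ i) * axis i 1))"
      by (metis sum_distrib_left)
    also have "\<dots> = (\<Sum>i\<in>UNIV. of_int (t $ i) * (of_nat (\<Prod>j\<in>UNIV - {i}. n j) * (of_nat (n i) * axis i 1)))"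
    proof (rule sum.cong)
      fix i
      show "of_nat k * (of_int (t $ i) * axis i (1::int)) =
          of_int (t $ i) * (of_nat (\<Prod>j\<in>UNIV - {i}. n j) * (of_nat (n i) * axis i 1))"
        by (subst kn[of i]) (simp add: mult_ac)
    qed simp
    also have "\<dots> \<in> period_lattice c"
      by (intro period_lattice_sum period_lattice_of_int_mult period_lattice_of_nat_mult n)
    finally show ?thesis .
  qed
  moreover have "k > 0" using n(1) by (simp add: k_def prod_pos)
  ultimately show ?thesis using that by blast
qed

text \<open>For suitable \<open>k, l > 0\<close>, the vector with entries
  \<open>k * l * \<sigma> i\<close> is a period of both configurations and lies in the open orthant,
  so it carries the comparison at the origin into the region of agreement.\<close>

lemma eq_at_0_if_eq_on_orthant:
  fixes y z :: "int ^ 'd \<Rightarrow> 'a"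
  assumes "strongly_periodic y" "strongly_periodic z"
    and s: "\<And>i. \<sigma> i \<noteq> (0::int)"
    and agree: "\<And>v. (\<And>i. v $ i * \<sigma> i > 0) \<Longrightarrow> z v = y (v + q)"
  shows "z 0 = y q"
proof -
  obtain k where k: "k > 0" "\<And>t. of_nat k * t \<in> period_lattice y"
    using strongly_periodic_common_multiple[OF assms(1)] by blast
  obtain l where l: "l > 0" "\<And>t. of_nat l * t \<in> period_lattice z"
    using strongly_periodic_common_multiple[OF assms(2)] by blast
  define v :: "int ^ 'd" where "v = of_nat (k * l) * (\<chi> i. \<sigma> i)"
  have "v = of_nat k * (of_nat l * (\<chi> i. \<sigma> i))" "v = of_nat l * (of_nat k * (\<chi> i. \<sigma> i))"
    by (simp_all add: v_def algebra_simps)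
  then have "v \<in> period_lattice y" "v \<in> period_lattice z"
    using k l by metis+
  then have "y (q + v) = y q" "z (0 + v) = z 0"
    by (auto simp: period_lattice_def simp del: add_0)
  moreover have "z v = y (v + q)"
  proof (rule agree)
    fix i
    have "v $ i * \<sigma> i = int (k * l) * (\<sigma> i)\<^sup>2"
      by (simp add: v_def of_nat_index power2_eq_square flip: of_nat_mult)
    then show "v $ i * \<sigma> i > 0" using k(1) l(1) s by simp
  qed
  ultimately show ?thesis by (simp add: add.commute)
qed

subsection \<open>Subshifts of strongly periodic configurations\<close>

text \<open>
  If \<open>\<phi> x\<close> were not isolated, configurations that agree with it on growing cubes but differ
  from it would, re-centred at a difference nearest to the origin, accumulate at a configuration that
  agrees with a translate of \<open>\<phi> x\<close> on an open orthant but not at the origin.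
\<close>

lemma strongly_periodic_isolated:
  fixes \<phi> :: "'x \<Rightarrow> int ^ 'd \<Rightarrow> 'a"
  assumes "compact_space \<T>"
    and local: "\<And>u b. openin \<T> {x \<in> topspace \<T>. \<phi> x u = b}"
    and shift: "\<And>x t. x \<in> topspace \<T> \<Longrightarrow> \<exists>x'\<in>topspace \<T>. \<phi> x' = translate t (\<phi> x)"
    and periodic: "\<And>x. x \<in> topspace \<T> \<Longrightarrow> strongly_periodic (\<phi> x)"
    and x: "x \<in> topspace \<T>"
  shows "\<exists>n::nat. \<forall>z\<in>topspace \<T>.
           (\<forall>v. (\<forall>i. \<bar>v $ i\<bar> \<le> int n) \<longrightarrow> \<phi> z v = \<phi> x v) \<longrightarrow> \<phi> z = \<phi> x"
proof (rule ccontr)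
  assume "\<not> ?thesis"
  then have ex: "\<exists>z\<in>topspace \<T>. (\<forall>v. (\<forall>i. \<bar>v $ i\<bar> \<le> int n) \<longrightarrow> \<phi> z v = \<phi> x v) \<and> \<phi> z \<noteq> \<phi> x"
    for n by blast
  obtain k where k: "k > 0" "\<And>t. of_nat k * t \<in> period_lattice (\<phi> x)"
    using strongly_periodic_common_multiple[OF periodic[OF x]] by blast
  \<comment> \<open>The finitely many types of a nearest difference: its position modulo the periods
    of \<open>\<phi> x\<close>, and the signs of an orthant pointing back to the origin.\<close>
  define P where "P = {q :: int ^ 'd. \<forall>i. q $ i \<in> {0..<int k}} \<times>
      {\<sigma> :: int ^ 'd. \<forall>i. \<sigma> $ i \<in> {-1, 1}}"
  have "finite P"
    unfolding P_def by (intro finite_cartesian_product finite_vec_box) auto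
  define C where "C = (\<lambda>(q, \<sigma> :: int ^ 'd) n. {z \<in> topspace \<T>. \<phi> z 0 \<noteq> \<phi> x q \<and>
      (\<forall>v. (\<forall>i. 0 < v $ i * \<sigma> $ i \<and> v $ i * \<sigma> $ i \<le> int n) \<longrightarrow> \<phi> z v = \<phi> x (v + q))})"
  have C_antimono: "C p n \<subseteq> C p m" if "m \<le> n" for m n p
    using that by (auto simp: C_def split: prod.splits) (meson of_nat_mono order_trans)
  have "\<exists>p\<in>P. C p n \<noteq> {}" for n
  proof -
    obtain z where z: "z \<in> topspace \<T>" "\<And>v. (\<And>i. \<bar>v $ i\<bar> \<le> int n) \<Longrightarrow> \<phi> z v = \<phi> x v" "\<phi> z \<noteq> \<phi> x"
      using ex[of n] by blast
    \<comment> \<open>The least such \<open>m\<close> is the distance, in the maximum norm, from the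
      origin to the nearest difference.\<close>
    define Q where "Q m \<longleftrightarrow> (\<exists>w. (\<forall>i. \<bar>w $ i\<bar> \<le> int m) \<and> \<phi> z w \<noteq> \<phi> x w)" for m
    obtain w0 where w0: "\<phi> z w0 \<noteq> \<phi> x w0" using z(3) by blast
    have "\<bar>w0 $ i\<bar> \<le> int (nat (\<Sum>i\<in>UNIV. \<bar>w0 $ i\<bar>))" for i
      using member_le_sum[of i UNIV "\<lambda>i. \<bar>w0 $ i\<bar>"] by simp
    then have "\<exists>m. Q m" using w0 unfolding Q_def by blast
    define m where "m = (LEAST m. Q m)"
    have "Q m" unfolding m_def using \<open>\<exists>m. Q m\<close> by (rule LeastI_ex)
    then obtain w where w: "\<And>i. \<bar>w $ i\<bar> \<le> int m" "\<phi> z w \<noteq> \<phi> x w" unfolding Q_def by blast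
    have below: "\<phi> z v = \<phi> x v" if "\<And>i. \<bar>v $ i\<bar> < int m" for v
    proof (rule ccontr)
      assume "\<phi> z v \<noteq> \<phi> x v"
      \<comment> \<open>Any coordinate would do; \<open>undefined\<close> merely names one.\<close>
      moreover have "m > 0" using that[of undefined] by linarith
      moreover have "\<bar>v $ i\<bar> \<le> int (m - 1)" for i using that[of i] by linarith
      ultimately have "Q (m - 1)" unfolding Q_def by blast
      then have "m \<le> m - 1" unfolding m_def by (rule Least_le)
      with \<open>m > 0\<close> show False by simp
    qed
    have "n < m"
    proof (rule ccontr)
      assume "\<not> n < m"
      then have "\<bar>w $ i\<bar> \<le> int n" for i using w(1)[of i] by linarith
      then show False using z(2) w(2) by blast
    qed
    define q where "q = (\<chi> i. w $ i mod int k)"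
    \<comment> \<open>Seen from \<open>w\<close>, this orthant points towards the origin, so up to
      \<open>n\<close> steps into it in each coordinate stay strictly inside the cube of radius
      \<open>m\<close>. Since \<open>n < m\<close>, overshooting the origin is harmless and a zero
      coordinate may take either sign.\<close>
    define \<sigma> :: "int ^ 'd" where "\<sigma> = (\<chi> i. if w $ i > 0 then -1 else 1)"
    have "(q, \<sigma>) \<in> P" using k(1) by (auto simp: P_def q_def \<sigma>_def)
    have xq: "\<phi> x (v + w) = \<phi> x (v + q)" for v
    proof -
      have "w = q + of_nat k * (\<chi> i. w $ i div int k)"
        by (simp add: vec_eq_iff q_def of_nat_index)
      then have "v + w = (v + q) + of_nat k * (\<chi> i. w $ i div int k)"
        by (simp only: add.assoc)
      then show ?thesis using k(2) by (simp only: period_lattice_def mem_Collect_eq)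
    qed
    obtain z' where z': "z' \<in> topspace \<T>" "\<phi> z' = translate w (\<phi> z)"
      using shift[OF z(1)] by blast
    have "\<phi> z' 0 \<noteq> \<phi> x q"
      using w(2) xq[of 0] by (simp add: z' translate_def)
    moreover have "\<phi> z' v = \<phi> x (v + q)" if v: "\<And>i. 0 < v $ i * \<sigma> $ i \<and> v $ i * \<sigma> $ i \<le> int n" for v
    proof -
      have "\<bar>(v + w) $ i\<bar> < int m" for i
        using v[of i] w(1)[of i] \<open>n < m\<close> by (auto simp: \<sigma>_def split: if_splits)
      then have "\<phi> z (v + w) = \<phi> x (v + w)" by (rule below)
      then show ?thesis by (simp add: z' translate_def xq)
    qed
    ultimately have "z' \<in> C (q, \<sigma>) n" using z' by (simp add: C_def)
    then show ?thesis using \<open>(q, \<sigma>) \<in> P\<close> by blast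
  qed
  \<comment> \<open>Pigeonhole: the sets shrink as \<open>n\<close> grows and \<open>P\<close> is
    finite, so one type must occur at every level.\<close>
  have "\<exists>p\<in>P. \<forall>n. C p n \<noteq> {}"
  proof (rule ccontr)
    assume "\<not> ?thesis"
    then obtain N where N: "\<And>p. p \<in> P \<Longrightarrow> C p (N p) = {}" by metis
    have "C p (Max (N ` P)) = {}" if "p \<in> P" for p
      using N[OF that] C_antimono[of "N p" "Max (N ` P)" p] that \<open>finite P\<close> by auto
    then show False using \<open>\<exists>p\<in>P. C p (Max (N ` P)) \<noteq> {}\<close> by blast
  qed
  then obtain q \<sigma> where "(q, \<sigma>) \<in> P" and ne: "\<And>n. C (q, \<sigma>) n \<noteq> {}" by auto
  \<comment> \<open>The complement is the union of the sets belonging to the other values, all open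
    by \<open>local\<close>.\<close>
  have closed: "closedin \<T> {z \<in> topspace \<T>. \<phi> z u = b}" for u b
  proof -
    have "openin \<T> (\<Union>b'\<in>-{b}. {z \<in> topspace \<T>. \<phi> z u = b'})"
      by (intro openin_Union) (use local in auto)
    moreover have "(\<Union>b'\<in>-{b}. {z \<in> topspace \<T>. \<phi> z u = b'}) = topspace \<T> - {z \<in> topspace \<T>. \<phi> z u = b}"
      by auto
    ultimately show ?thesis by (simp add: closedin_def Collect_restrict)
  qed
  have "closedin \<T> (C (q, \<sigma>) n)" for n
  proof -
    let ?V = "{v. \<forall>i. 0 < v $ i * \<sigma> $ i \<and> v $ i * \<sigma> $ i \<le> int n}"
    have "C (q, \<sigma>) n = (topspace \<T> - {z \<in> topspace \<T>. \<phi> z 0 = \<phi> x q}) \<inter>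
        (\<Inter>v. if v \<in> ?V then {z \<in> topspace \<T>. \<phi> z v = \<phi> x (v + q)} else topspace \<T>)"
      by (auto simp: C_def split: if_splits)
    moreover have "closedin \<T> \<dots>"
      by (intro closedin_Int closedin_diff closedin_topspace local closedin_Inter)
        (use closed in \<open>auto split: if_splits\<close>)
    ultimately show ?thesis by simp
  qed
  moreover have "decseq (C (q, \<sigma>))"
    using C_antimono by (auto simp: decseq_def)
  ultimately have "(\<Inter>n. C (q, \<sigma>) n) \<noteq> {}"
    using compact_space_imp_nest[OF \<open>compact_space \<T>\<close>] ne by metis
  then obtain z where z: "\<And>n. z \<in> C (q, \<sigma>) n" by auto
  then have "z \<in> topspace \<T>" "\<phi> z 0 \<noteq> \<phi> x q" by (auto simp: C_def)
  moreover have "\<phi> z 0 = \<phi> x q"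
  proof (rule eq_at_0_if_eq_on_orthant)
    show "\<sigma> $ i \<noteq> 0" for i using \<open>(q, \<sigma>) \<in> P\<close> by (auto simp: P_def dest: spec[of _ i])
    fix v assume v: "\<And>i. v $ i * \<sigma> $ i > 0"
    have "v $ i * \<sigma> $ i \<le> int (nat (\<Sum>i\<in>UNIV. v $ i * \<sigma> $ i))" for i
      using member_le_sum[of i UNIV "\<lambda>i. v $ i * \<sigma> $ i"] v by (simp add: less_imp_le)
    then show "\<phi> z v = \<phi> x (v + q)"
      using z[of "nat (\<Sum>i\<in>UNIV. v $ i * \<sigma> $ i)"] v by (simp add: C_def)
  qed (use periodic x \<open>z \<in> topspace \<T>\<close> in auto)
  ultimately show False by blast
qed

text \<open>Every point has an open neighbourhood on which \<open>\<phi>\<close> is constant, and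
  finitely many of these cover the space. Working with a map out of a compact space avoids having to
  show that the image is itself a subshift.\<close>

lemma strongly_periodic_finite_image:
  fixes \<phi> :: "'x \<Rightarrow> int ^ 'd \<Rightarrow> 'a"
  assumes compact: "compact_space \<T>"
    and local: "\<And>u b. openin \<T> {x \<in> topspace \<T>. \<phi> x u = b}"
    and shift: "\<And>x t. x \<in> topspace \<T> \<Longrightarrow> \<exists>x'\<in>topspace \<T>. \<phi> x' = translate t (\<phi> x)"
    and periodic: "\<And>x. x \<in> topspace \<T> \<Longrightarrow> strongly_periodic (\<phi> x)"
  shows "finite (\<phi> ` topspace \<T>)"
proof -
  obtain n :: "'x \<Rightarrow> nat" where n: "\<And>x z. x \<in> topspace \<T> \<Longrightarrow> z \<in> topspace \<T> \<Longrightarrow>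
      (\<forall>v. (\<forall>i. \<bar>v $ i\<bar> \<le> int (n x)) \<longrightarrow> \<phi> z v = \<phi> x v) \<Longrightarrow> \<phi> z = \<phi> x"
    using strongly_periodic_isolated[OF assms] by metis
  define cube where "cube x = {v :: int ^ 'd. \<forall>i. \<bar>v $ i\<bar> \<le> int (n x)}" for x
  have fin: "finite (cube x)" for x
    using finite_vec_box[of "\<lambda>_. {- int (n x) .. int (n x)}"]
    by (simp add: cube_def abs_le_iff minus_le_iff conj_commute)
  define U where "U x = topspace \<T> \<inter> (\<Inter>v\<in>cube x. {z \<in> topspace \<T>. \<phi> z v = \<phi> x v})" for x
  \<comment> \<open>Keeps the intersection in \<open>U\<close> from being empty-indexed, so that it
    is open as a finite intersection.\<close>
  have "0 \<in> cube x" for x by (simp add: cube_def)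
  then have "openin \<T> (U x)" for x
    unfolding U_def by (intro openin_Int openin_topspace openin_INT2 fin local) auto
  moreover have "topspace \<T> \<subseteq> \<Union>(U ` topspace \<T>)" by (auto simp: U_def)
  ultimately obtain F where F: "finite F" "F \<subseteq> U ` topspace \<T>" "topspace \<T> \<subseteq> \<Union>F"
    using compact unfolding compact_space_alt by (metis (no_types, lifting) imageE)
  then obtain G where G: "finite G" "G \<subseteq> topspace \<T>" "F = U ` G"
    by (meson finite_subset_image)
  have "\<phi> ` topspace \<T> \<subseteq> \<phi> ` G"
  proof
    fix y assume "y \<in> \<phi> ` topspace \<T>"
    then obtain z where "z \<in> topspace \<T>" "y = \<phi> z" by blast
    then obtain x where "x \<in> G" "z \<in> U x" using F G by auto
    then have "\<phi> z = \<phi> x" using G(2) \<open>z \<in> topspace \<T>\<close> by (intro n) (auto simp: U_def cube_def)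
    then show "y \<in> \<phi> ` G" using \<open>x \<in> G\<close> \<open>y = \<phi> z\<close> by blast
  qed
  then show ?thesis using G(1) finite_surj by blast
qed

section \<open>Compactness of subshifts and a common period of all products
  \<open>fc\<close>\<close>

lemma compact_space_subshift:
  assumes "finite A" "subshift A X"
  shows "compact_space (subtopology (product_topology (\<lambda>_. discrete_topology A) UNIV) X)"
proof -
  have "compact_space (product_topology (\<lambda>_::int ^ 'd. discrete_topology A) UNIV)"
    using assms(1) by (simp add: compact_space_product_topology compact_space_discrete_topology)
  then show ?thesis
    using assms(2) by (intro compact_space_subtopology closedin_compact_space) (auto simp: subshift_def)
qed

lemma subshift_range: "subshift A X \<Longrightarrow> c \<in> X \<Longrightarrow> c u \<in> A"
  unfolding subshift_def by (auto dest!: closedin_subset) (metis PiE_mem UNIV_I subsetD)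

text \<open>A condition reading only the cells in \<open>W\<close> holds on a whole cylinder around
  each point where it holds. It will be applied to the value of \<open>fc\<close> at a single
  position.\<close>

lemma openin_finite_window:
  fixes X :: "(int ^ 'd \<Rightarrow> int) set" and Q :: "(int ^ 'd \<Rightarrow> int) \<Rightarrow> bool"
  assumes X: "\<And>c u. c \<in> X \<Longrightarrow> c u \<in> A" and "finite W"
    and window: "\<And>c c'. (\<And>u. u \<in> W \<Longrightarrow> c u = c' u) \<Longrightarrow> Q c = Q c'"
  shows "openin (subtopology (product_topology (\<lambda>_. discrete_topology A) UNIV) X) {c \<in> X. Q c}"
proof (subst openin_subopen, intro ballI)
  fix c assume c: "c \<in> {c \<in> X. Q c}"
  let ?K = "Pi\<^sub>E UNIV (\<lambda>u. if u \<in> W then {c u} else A)"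
  have "openin (product_topology (\<lambda>_. discrete_topology A) UNIV) ?K"
    unfolding product_topology_def
    using X c assms(2)
    by (intro product_topology_basis[unfolded product_topology_def])
      (auto intro: rev_finite_subset[OF assms(2)] split: if_splits)
  then have "openin (subtopology (product_topology (\<lambda>_. discrete_topology A) UNIV) X) (X \<inter> ?K)"
    by (simp add: openin_subtopology_Int2)
  moreover have "c \<in> X \<inter> ?K" using c X by auto
  moreover have "X \<inter> ?K \<subseteq> {c \<in> X. Q c}"
  proof
    fix c' assume c': "c' \<in> X \<inter> ?K"
    then have "c' u = c u" if "u \<in> W" for u
      using that by (auto dest!: PiE_mem[where x = u])
    then have "Q c' = Q c" by (rule window)
    then show "c' \<in> {c \<in> X. Q c}" using c c' by auto
  qed
  ultimately show "\<exists>T. openin (subtopology (product_topology (\<lambda>_. discrete_topology A) UNIV) X) T \<and>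
      c \<in> T \<and> T \<subseteq> {c \<in> X. Q c}" by blast
qed

lemma poly_act_translate:
  "poly_act f (config_series (translate t c)) = translate t (poly_act f (config_series c))"
  by (simp add: poly_act_def config_series_def translate_def fun_eq_iff algebra_simps)

text \<open>Compactness leaves only finitely many configurations \<open>fc\<close>, so the product
  of their individual multipliers serves them all.\<close>

lemma Per_common_period:
  fixes X :: "(int ^ 'd \<Rightarrow> int) set"
  assumes "finite A" "subshift A X" "f \<in> Per X"
  obtains k :: nat where "k > 0"
    "\<And>c t. c \<in> X \<Longrightarrow> of_nat k * t \<in> period_lattice (poly_act f (config_series c))"
proof -
  define \<phi> where "\<phi> c = poly_act f (config_series c)" for c :: "int ^ 'd \<Rightarrow> int"
  define \<T> where "\<T> = subtopology (product_topology (\<lambda>_::int ^ 'd. discrete_topology A) UNIV) X"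
  have X: "\<And>c u. c \<in> X \<Longrightarrow> c u \<in> A" using subshift_range[OF assms(2)] by blast
  then have top: "topspace \<T> = X" unfolding \<T>_def by auto
  have per: "strongly_periodic (\<phi> c)" if "c \<in> X" for c
    using assms(3) that by (simp add: Per_def \<phi>_def series_mult_eq_poly_act)
  have "finite (\<phi> ` topspace \<T>)"
  proof (rule strongly_periodic_finite_image)
    show "compact_space \<T>" unfolding \<T>_def by (rule compact_space_subshift[OF assms(1,2)])
    show "openin \<T> {x \<in> topspace \<T>. \<phi> x u = b}" for u b
      unfolding top unfolding \<T>_def
    proof (rule openin_finite_window[where W = "(\<lambda>v. u - v) ` Poly_Mapping.keys f"])
      fix c c' :: "int ^ 'd \<Rightarrow> int"
      assume "\<And>w. w \<in> (\<lambda>v. u - v) ` Poly_Mapping.keys f \<Longrightarrow> c w = c' w"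
      then have "\<phi> c u = \<phi> c' u"
        unfolding \<phi>_def poly_act_def config_series_def by (intro sum.cong) auto
      then show "(\<phi> c u = b) = (\<phi> c' u = b)" by simp
    qed (use X in auto)
    show "\<exists>x'\<in>topspace \<T>. \<phi> x' = translate t (\<phi> x)" if "x \<in> topspace \<T>" for x t
      using that assms(2) unfolding top \<phi>_def by (metis poly_act_translate subshift_def)
  qed (use per top in auto)
  then have fin: "finite (\<phi> ` X)" by (simp add: top)
  have "\<exists>n>0. \<forall>t. of_nat n * t \<in> period_lattice y" if "y \<in> \<phi> ` X" for y
    using that per strongly_periodic_common_multiple by blast
  then obtain n :: "_ \<Rightarrow> nat" where n: "\<And>y. y \<in> \<phi> ` X \<Longrightarrow> n y > 0"
    "\<And>y t. y \<in> \<phi> ` X \<Longrightarrow> of_nat (n y) * t \<in> period_lattice y" by metis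
  define k where "k = (\<Prod>y\<in>\<phi> ` X. n y)"
  have "k > 0" unfolding k_def using n(1) by (intro prod_pos) auto
  moreover have "of_nat k * t \<in> period_lattice (\<phi> c)" if "c \<in> X" for c t
  proof -
    have "k = n (\<phi> c) * (\<Prod>y\<in>\<phi> ` X - {\<phi> c}. n y)"
      unfolding k_def using fin that by (intro prod.remove) auto
    then have "of_nat k * t = of_nat (n (\<phi> c)) * (of_nat (\<Prod>y\<in>\<phi> ` X - {\<phi> c}. n y) * t)"
      by (simp add: mult.assoc)
    then show ?thesis using n(2) that by simp
  qed
  ultimately show ?thesis using that unfolding \<phi>_def by blast
qed

section \<open>From periodic products to annihilators\<close>

lemma exists_lattice_vector_notin_subspace:
  assumes "subspace S" "S \<noteq> UNIV"
  obtains w :: "int ^ 'd" where "real_vec w \<notin> S"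
proof (rule ccontr)
  assume "\<not> thesis"
  then have S: "real_vec w \<in> S" for w :: "int ^ 'd" using that by blast
  have "axis i 1 \<in> S" for i
  proof -
    have "real_vec (axis i 1 :: int ^ 'd) = axis i 1"
      by (simp add: real_vec_def vec_eq_iff axis_def)
    then show ?thesis by (metis S)
  qed
  then have "Basis \<subseteq> S" by (auto simp: Basis_vec_def)
  then have "span Basis \<subseteq> S" using assms(1) by (rule span_minimal)
  then show False using assms(2) by (simp add: top.extremum_unique)
qed

text \<open>For a common period \<open>t\<close>, the product \<open>(x^t - 1) * f\<close>
  annihilates \<open>X\<close>. Choosing \<open>t\<close> so that the support of \<open>f\<close>
  shifted by \<open>t\<close> misses \<open>S\<close> keeps the part of the support inside
  \<open>S\<close> unchanged.\<close>

lemma Per_imp_Ann: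
  fixes X :: "(int ^ 'd \<Rightarrow> int) set"
  assumes "finite A" "subshift A X" "subspace S" "S \<noteq> UNIV" "f \<in> Per X"
    and f: "real_vec ` Poly_Mapping.keys f \<inter> S = {0}"
  obtains g where "g \<in> Ann X" "real_vec ` Poly_Mapping.keys g \<inter> S = {0}"
proof -
  obtain k :: nat where k: "k > 0"
    "\<And>c t. c \<in> X \<Longrightarrow> of_nat k * t \<in> period_lattice (poly_act f (config_series c))"
    using Per_common_period[OF assms(1,2,5)] by blast
  obtain w :: "int ^ 'd" where w: "real_vec w \<notin> S"
    using exists_lattice_vector_notin_subspace[OF assms(3,4)] by blast
  define bad where "bad v = {j. real_vec (v + of_nat (k * j) * w) \<in> S}" for v
  have "finite (bad v)" for v
  proof -
    \<comment> \<open>Two different bad values would put a nonzero multiple of \<open>w\<close> into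
      \<open>S\<close>.\<close>
    have "i = j" if "i \<in> bad v" "j \<in> bad v" for i j
    proof (rule ccontr)
      assume "i \<noteq> j"
      have "real_vec (v + of_nat (k * i) * w) - real_vec (v + of_nat (k * j) * w) \<in> S"
        using that assms(3) by (auto simp: bad_def intro: subspace_diff)
      also have "real_vec (v + of_nat (k * i) * w) - real_vec (v + of_nat (k * j) * w)
          = (real k * (real i - real j)) *\<^sub>R real_vec w"
        by (simp add: real_vec_add real_vec_of_nat_mult scaleR_left_diff_distrib right_diff_distrib
            del: of_nat_mult) simp
      finally show False
        using w subspace_scale[OF assms(3), of _ "1 / (real k * (real i - real j))"] k(1) \<open>i \<noteq> j\<close>
        by fastforce
    qed
    then have "bad v \<subseteq> {SOME j. j \<in> bad v}" by (metis singletonI someI_ex subsetI)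
    then show ?thesis by (rule finite_subset) simp
  qed
  then have "finite (\<Union>v\<in>Poly_Mapping.keys f. bad v)" by simp
  then obtain j where j: "\<And>v. v \<in> Poly_Mapping.keys f \<Longrightarrow> j \<notin> bad v"
    using ex_new_if_finite[OF infinite_UNIV_nat] by blast
  define t where "t = of_nat (k * j) * w"
  define g where "g = (laurent_monom t - 1) * f"
  have lookup_g: "Poly_Mapping.lookup g u = Poly_Mapping.lookup f (u - t) - Poly_Mapping.lookup f u" for u
  proof -
    have "Poly_Mapping.lookup (laurent_monom t * f) u = Poly_Mapping.lookup f (u - t)"
    proof -
      have "laurent_monom t * f = (\<Sum>v\<in>Poly_Mapping.keys f. Poly_Mapping.single (t + v) (Poly_Mapping.lookup f v))"
        by (subst poly_mapping_eq_sum_single[of f])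
          (simp add: laurent_monom_def sum_distrib_left mult_single)
      then have "Poly_Mapping.lookup (laurent_monom t * f) u
          = (\<Sum>v\<in>Poly_Mapping.keys f. if v = u - t then Poly_Mapping.lookup f v else 0)"
        by (simp only: lookup_sum lookup_single when_def) (intro sum.cong, auto)
      then show ?thesis by (simp add: sum.delta in_keys_iff)
    qed
    then show ?thesis by (simp add: g_def left_diff_distrib lookup_minus)
  qed
  have "g \<in> Ann X"
    unfolding in_Ann_iff
  proof (intro ballI ext)
    fix c u assume "c \<in> X"
    let ?y = "poly_act f (config_series c)"
    have "of_nat k * (of_nat j * w) \<in> period_lattice ?y" by (rule k(2)[OF \<open>c \<in> X\<close>])
    then have "?y ((u - t) + t) = ?y (u - t)"
      by (simp only: period_lattice_def t_def of_nat_mult mult.assoc mem_Collect_eq)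
    then show "poly_act g (config_series c) u = 0"
      by (simp add: g_def poly_act_mult poly_act_monom_minus_1)
  qed
  moreover have "real_vec ` Poly_Mapping.keys g \<inter> S = {0}"
  proof -
    have "u \<in> Poly_Mapping.keys g \<longleftrightarrow> u \<in> Poly_Mapping.keys f" if "real_vec u \<in> S" for u
    proof -
      have "u - t \<notin> Poly_Mapping.keys f"
        using j[of "u - t"] that by (auto simp: bad_def t_def)
      then show ?thesis by (simp add: in_keys_iff lookup_g)
    qed
    then show ?thesis using f by (auto 4 4)
  qed
  ultimately show ?thesis using that by blast
qed

subsection \<open>Integer coefficients\<close>

text \<open>\<open>z\<close> extends to a basis of the complex numbers over the rationals, on which
  a linear map may be prescribed freely.\<close>

lemma rational_functional:
  fixes z :: complex
  assumes "z \<noteq> 0"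
  obtains L :: "complex \<Rightarrow> rat" where "L z = 1" "\<And>x y. L (x + y) = L x + L y"
    "\<And>q x. L (of_rat q * x) = q * L x"
proof -
  have vs: "vector_space (\<lambda>(q::rat) (x::complex). of_rat q * x)"
    by unfold_locales (auto simp: algebra_simps of_rat_add of_rat_mult)
  have vs': "vector_space ((*) :: rat \<Rightarrow> rat \<Rightarrow> rat)"
    by unfold_locales (auto simp: algebra_simps)
  interpret vector_space_pair "\<lambda>(q::rat) (x::complex). of_rat q * x" "(*) :: rat \<Rightarrow> rat \<Rightarrow> rat"
    using vs vs' by (simp add: vector_space_pair_def)
  have "vs1.independent {z}" using assms by simp
  then obtain L where L: "Vector_Spaces.linear (\<lambda>(q::rat) (x::complex). of_rat q * x) (*) L"
    "\<forall>x\<in>{z}. L x = 1"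
    using linear_independent_extend[of "{z}" "\<lambda>_. 1"] by blast
  interpret L: Vector_Spaces.linear "\<lambda>(q::rat) (x::complex). of_rat q * x" "(*)" L by (rule L(1))
  show ?thesis using that[of L] L(2) L.add L.scale by simp
qed

lemma common_denominator:
  fixes q :: "'i \<Rightarrow> rat"
  assumes "finite V"
  obtains N :: int and a where "N > 0" "\<And>v. v \<in> V \<Longrightarrow> of_int (a v) = of_int N * q v"
proof -
  define d where "d v = snd (quotient_of (q v))" for v
  define N where "N = (\<Prod>v\<in>V. d v)"
  have d: "d v > 0" "of_int (d v) * q v = of_int (fst (quotient_of (q v)))" for v
    using quotient_of_denom_pos'[of "q v"] quotient_of_div[of "q v", OF prod.collapse[symmetric]]
    by (simp_all add: d_def nonzero_eq_divide_eq mult.commute)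
  have "\<exists>a. of_int a = of_int N * q v" if "v \<in> V" for v
  proof -
    have "N = d v * (\<Prod>w\<in>V - {v}. d w)"
      unfolding N_def using assms that by (intro prod.remove) auto
    then have "of_int N * q v = of_int ((\<Prod>w\<in>V - {v}. d w) * fst (quotient_of (q v)))"
      using d(2)[of v] by (simp add: algebra_simps)
    then show ?thesis by metis
  qed
  moreover have "N > 0" unfolding N_def using d(1) by (intro prod_pos) auto
  ultimately show ?thesis using that by metis
qed

text \<open>Since configurations have integer values, a rational-linear functional can be applied to
  the coefficients alone; \<open>N\<close> then clears denominators. Normalising the functional to 1
  at the coefficient of \<open>w\<close> keeps that coefficient nonzero.\<close>

lemma Ann_imp_integer_relation:
  fixes X :: "(int ^ 'd \<Rightarrow> int) set"
  assumes "g \<in> Ann X" "w \<in> Poly_Mapping.keys g"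
  obtains a :: "int ^ 'd \<Rightarrow> int" where "a w \<noteq> 0"
    "\<And>c u. c \<in> X \<Longrightarrow> (\<Sum>v\<in>Poly_Mapping.keys g. a v * c (u - v)) = 0"
proof -
  obtain L :: "complex \<Rightarrow> rat" where L: "L (Poly_Mapping.lookup g w) = 1"
    "\<And>x y. L (x + y) = L x + L y" "\<And>q x. L (of_rat q * x) = q * L x"
    using rational_functional assms(2) in_keys_iff by metis
  obtain N a where N: "N > 0" and
    a: "\<And>v. v \<in> Poly_Mapping.keys g \<Longrightarrow> (of_int (a v) :: rat) = of_int N * L (Poly_Mapping.lookup g v)"
    using common_denominator[of "Poly_Mapping.keys g" "\<lambda>v. L (Poly_Mapping.lookup g v)"] by auto
  have L0: "L 0 = 0" using L(2)[of 0 0] by simp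
  have Lsum: "L (\<Sum>i\<in>I. h i) = (\<Sum>i\<in>I. L (h i))" for h :: "int ^ 'd \<Rightarrow> complex" and I
    by (induction I rule: infinite_finite_induct) (auto simp: L0 L(2))
  have Lint: "L (x * of_int n) = L x * of_int n" for x n
    using L(3)[of "of_int n" x] by (simp add: mult.commute)
  have "(\<Sum>v\<in>Poly_Mapping.keys g. a v * c (u - v)) = 0" if "c \<in> X" for c u
  proof -
    have "0 = (\<Sum>v\<in>Poly_Mapping.keys g. Poly_Mapping.lookup g v * of_int (c (u - v)))"
      using assms(1) that by (auto simp: in_Ann_iff poly_act_def config_series_def fun_eq_iff)
    then have "L 0 = L (\<Sum>v\<in>Poly_Mapping.keys g. Poly_Mapping.lookup g v * of_int (c (u - v)))"
      by (rule arg_cong)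
    then have "L 0 = (\<Sum>v\<in>Poly_Mapping.keys g. L (Poly_Mapping.lookup g v) * of_int (c (u - v)))"
      unfolding Lsum Lint .
    then have "0 = of_int N * (\<Sum>v\<in>Poly_Mapping.keys g. L (Poly_Mapping.lookup g v) * of_int (c (u - v)))"
      by (simp add: L0)
    also have "\<dots> = (\<Sum>v\<in>Poly_Mapping.keys g. of_int (a v) * of_int (c (u - v)))"
      by (simp add: a sum_distrib_left mult.assoc)
    also have "\<dots> = of_int (\<Sum>v\<in>Poly_Mapping.keys g. a v * c (u - v))" by simp
    finally show ?thesis by (metis of_int_eq_0_iff)
  qed
  moreover have "a w \<noteq> 0" using a[OF assms(2)] N L(1) by auto
  ultimately show ?thesis using that by blast
qed

text \<open>The dilated relations read \<open>\<Sum>v\<in>V. b v * y v ^ i\<close>. Eliminating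
  every \<open>y w\<close> with \<open>w \<noteq> 0\<close> leaves only the term at 0, where
  \<open>y 0 = 1\<close> and \<open>b 0\<close> is a nonzero constant, hence a unit.\<close>

lemma Ann_prod_monom:
  fixes X :: "(int ^ 'd \<Rightarrow> int) set" and V :: "(int ^ 'd) set"
  assumes "finite V" "0 \<in> V" "a 0 \<noteq> 0"
    and ann: "\<And>c u. c \<in> X \<Longrightarrow> (\<Sum>v\<in>V. a v * c (u - v)) = 0"
    and bound: "\<And>c u. c \<in> X \<Longrightarrow> \<bar>c u\<bar> \<le> B"
  obtains r :: nat where "r > 0"
    "(\<Prod>v\<in>V - {0}. laurent_monom (of_nat r * v) - 1) \<in> Ann X"
proof -
  obtain r :: nat where r: "r > 0"
    "\<And>i c u. c \<in> X \<Longrightarrow> (\<Sum>v\<in>V. a v * c (u - of_nat (1 + i * r) * v)) = 0"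
    by (rule annihilator_dilate_progression[where X = X and a = a and V = V and e = "\<lambda>v. v" and B = B]) (use ann bound in auto)
  define b :: "int ^ 'd \<Rightarrow> 'd laurent" where "b v = Poly_Mapping.single v (of_int (a v))" for v
  define y :: "int ^ 'd \<Rightarrow> 'd laurent" where "y v = laurent_monom (of_nat r * v)" for v
  have "(\<Sum>v\<in>V. b v * y v ^ i) \<in> Ann X" for i
    unfolding in_Ann_iff
  proof (intro ballI ext)
    fix c u assume "c \<in> X"
    have "b v * y v ^ i = Poly_Mapping.single (of_nat (1 + i * r) * v) (of_int (a v))" for v
      by (simp add: b_def y_def laurent_monom_def single_power mult_single algebra_simps)
    then have "poly_act (\<Sum>v\<in>V. b v * y v ^ i) (config_series c) u
        = of_int (\<Sum>v\<in>V. a v * c (u - of_nat (1 + i * r) * v))"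
      by (simp add: poly_act_sum poly_act_single config_series_def)
    then show "poly_act (\<Sum>v\<in>V. b v * y v ^ i) (config_series c) u = 0"
      using r(2)[OF \<open>c \<in> X\<close>] by (simp only: of_int_0)
  qed
  then have "(\<Sum>v\<in>V. b v * (\<Prod>w\<in>V - {0}. y v - y w) * y v ^ 0) \<in> Ann X"
    using assms(1) by (intro Ann_eliminate) auto
  also have "(\<Sum>v\<in>V. b v * (\<Prod>w\<in>V - {0}. y v - y w) * y v ^ 0)
      = (\<Sum>v\<in>{0}. b v * (\<Prod>w\<in>V - {0}. y v - y w) * y v ^ 0)"
  proof (rule sum.mono_neutral_right)
    have "(\<Prod>w\<in>V - {0}. y v - y w) = 0" if "v \<in> V - {0}" for v
      using assms(1) that by (intro prod_zero) auto
    then show "\<forall>v\<in>V - {0}. b v * (\<Prod>w\<in>V - {0}. y v - y w) * y v ^ 0 = 0" by simp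
  qed (use assms in auto)
  also have "\<dots> = b 0 * (\<Prod>w\<in>V - {0}. 1 - y w)"
    by (simp add: y_def laurent_monom_def)
  finally have "Poly_Mapping.single 0 (1 / of_int (a 0)) * (b 0 * (\<Prod>w\<in>V - {0}. 1 - y w)) \<in> Ann X"
    by (rule Ann_mult)
  also have "Poly_Mapping.single 0 (1 / of_int (a 0)) * (b 0 * (\<Prod>w\<in>V - {0}. 1 - y w))
      = (\<Prod>w\<in>V - {0}. 1 - y w)"
    using \<open>a 0 \<noteq> 0\<close> by (simp add: b_def mult_single del: single_of_int flip: mult.assoc)
  finally have "(\<Prod>w\<in>V - {0}. 1 - y w) \<in> Ann X" .
  \<comment> \<open>The two products differ only by a sign in each factor.\<close>
  moreover have "(\<Prod>w\<in>V - {0}. 1 - y w) dvd (\<Prod>w\<in>V - {0}. y w - 1)"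
    by (intro prod_dvd_prod) (metis dvd_minus_iff dvd_refl minus_diff_eq)
  ultimately have "(\<Prod>w\<in>V - {0}. y w - 1) \<in> Ann X" by (rule Ann_dvd)
  then show ?thesis using r(1) that unfolding y_def by blast
qed

subsection \<open>Merging parallel factors\<close>

lemma laurent_monom_minus_1_dvd:
  fixes t :: "int ^ 'd"
  shows "laurent_monom t - 1 dvd laurent_monom (of_int n * t) - 1"
proof (cases n rule: int_cases2)
  case (nonneg m)
  have "laurent_monom (of_nat m * t) = laurent_monom t ^ m"
    by (simp add: laurent_monom_def single_power)
  then have "laurent_monom t - 1 dvd laurent_monom (of_nat m * t) - 1"
    by (simp add: power_diff_1_eq)
  then show ?thesis using nonneg by simp
next
  case (nonpos m)
  have "laurent_monom (of_nat m * t) = laurent_monom t ^ m"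
    by (simp add: laurent_monom_def single_power)
  \<comment> \<open>For negative multiples: \<open>x^(-s) - 1\<close> is \<open>x^s - 1\<close>
    times the unit \<open>- x^(-s)\<close>.\<close>
  then have "laurent_monom t - 1 dvd - laurent_monom (- (of_nat m * t)) * (laurent_monom (of_nat m * t) - 1)"
    by (simp add: power_diff_1_eq)
  also have "\<dots> = laurent_monom (of_int n * t) - 1"
    using nonpos by (simp add: laurent_monom_def mult_single algebra_simps)
  finally show ?thesis .
qed

text \<open>
  If \<open>(x\<^sup>e - 1)\<^sup>2 d = 0\<close>, then \<open>d\<close> is affine along each line in direction \<open>e\<close>; a bounded one is
  therefore constant along these lines.
\<close>

lemma monom_minus_1_square_cancel:
  fixes d :: "int ^ 'd \<Rightarrow> complex"
  assumes sq: "poly_act ((laurent_monom e - 1) * (laurent_monom e - 1)) d = (\<lambda>_. 0)"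
    and bound: "\<And>u. norm (d u) \<le> B"
  shows "poly_act (laurent_monom e - 1) d = (\<lambda>_. 0)"
proof
  fix u
  define \<delta> where "\<delta> = poly_act (laurent_monom e - 1) d"
  have \<delta>: "\<delta> u = d (u - e) - d u" for u by (simp add: \<delta>_def poly_act_monom_minus_1)
  have step: "\<delta> (u - e) - \<delta> u = 0" for u
    using fun_cong[OF sq, of u] by (simp add: poly_act_mult poly_act_monom_minus_1 flip: \<delta>_def)
  have "\<delta> (u - of_nat n * e) = \<delta> u" for n
  proof (induction n)
    case (Suc n)
    have "u - of_nat (Suc n) * e = (u - of_nat n * e) - e" by (simp add: algebra_simps)
    then show ?case using step[of "u - of_nat n * e"] Suc by (simp only: right_minus_eq)
  qed simp
  then have "d (u - of_nat n * e) = d u + of_nat n * \<delta> u" for n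
  proof (induction n)
    case (Suc n)
    have "d (u - of_nat (Suc n) * e) = d (u - of_nat n * e) + \<delta> (u - of_nat n * e)"
      by (simp add: \<delta> algebra_simps)
    then show ?case using Suc by (simp add: algebra_simps)
  qed simp
  then have le: "of_nat n * norm (\<delta> u) \<le> 2 * B" for n
    using norm_triangle_ineq4[of "d (u - of_nat n * e)" "d u"] bound[of u] bound[of "u - of_nat n * e"]
    by (simp add: norm_mult)
  have "norm (\<delta> u) = 0"
  proof (rule ccontr)
    assume "norm (\<delta> u) \<noteq> 0"
    then obtain n where "2 * B < of_nat n * norm (\<delta> u)"
      using reals_Archimedean3[of "norm (\<delta> u)"] by auto
    with le[of n] show False by simp
  qed
  then show "poly_act (laurent_monom e - 1) d u = 0" by (simp add: \<delta>_def)
qed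

lemma poly_act_bounded:
  fixes c :: "int ^ 'd \<Rightarrow> complex"
  assumes "\<And>u. norm (c u) \<le> B"
  shows "norm (poly_act f c u) \<le> (\<Sum>v\<in>Poly_Mapping.keys f. norm (Poly_Mapping.lookup f v) * B)"
  unfolding poly_act_def
  by (intro sum_norm_le) (auto simp: norm_mult intro!: mult_left_mono assms)

text \<open>The preceding cancellation is applied to the image of each configuration under
  \<open>h\<close>, which is again bounded.\<close>

lemma Ann_monom_square_cancel:
  fixes X :: "(int ^ 'd \<Rightarrow> int) set"
  assumes "(laurent_monom e - 1) * (laurent_monom e - 1) * h \<in> Ann X"
    and bound: "\<And>c u. c \<in> X \<Longrightarrow> \<bar>c u\<bar> \<le> B"
  shows "(laurent_monom e - 1) * h \<in> Ann X"
  unfolding in_Ann_iff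
proof
  fix c assume "c \<in> X"
  have "norm (config_series c u) \<le> of_int B" for u
    using bound[OF \<open>c \<in> X\<close>, of u] by (simp add: config_series_def flip: of_int_abs)
  then show "poly_act ((laurent_monom e - 1) * h) (config_series c) = (\<lambda>_. 0)"
    unfolding poly_act_mult[of "laurent_monom e - 1" h]
    using assms(1) \<open>c \<in> X\<close>
    by (intro monom_minus_1_square_cancel[OF _ poly_act_bounded])
      (auto simp: in_Ann_iff poly_act_mult[of "_ * _" h])
qed

text \<open>Dependence gives a real ratio; cross-multiplying with a coordinate \<open>i\<close>
  where \<open>t\<close> is nonzero replaces it by the integers \<open>t $ i\<close> and
  \<open>s $ i\<close>.\<close>

lemma common_multiple_if_dependent:
  assumes "s \<noteq> 0" "t \<noteq> 0" "s \<noteq> t" "\<not> lin_indep_pair s t"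
  obtains m n :: int where "of_int m * s = of_int n * t" "m \<noteq> 0" "n \<noteq> 0"
proof -
  have ne: "real_vec s \<noteq> real_vec t" "real_vec s \<noteq> 0" "real_vec t \<noteq> 0"
    using assms inj_real_vec[THEN injD] by (auto simp: real_vec_eq_0_iff)
  have "dependent (insert (real_vec s) {real_vec t})"
    using assms by (simp add: lin_indep_pair_def)
  then have "real_vec s \<in> span {real_vec t}"
    using ne independent_insert[of "real_vec s" "{real_vec t}"] by auto
  then obtain r where r: "real_vec s = r *\<^sub>R real_vec t" by (auto simp: span_singleton)
  then have r': "real_of_int (s $ j) = r * real_of_int (t $ j)" for j
    by (simp add: real_vec_def vec_eq_iff)
  have "r \<noteq> 0" using ne(2) r by auto
  obtain i where i: "t $ i \<noteq> 0" using assms(2) by (auto simp: vec_eq_iff)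
  have "real_of_int (t $ i * s $ j) = real_of_int (s $ i * t $ j)" for j
    by (simp add: r')
  then have "t $ i * s $ j = s $ i * t $ j" for j by (simp only: of_int_eq_iff)
  then have "of_int (t $ i) * s = of_int (s $ i) * t"
    by (simp add: vec_eq_iff of_int_index_vec)
  moreover have "s $ i \<noteq> 0" using r'[of i] i \<open>r \<noteq> 0\<close> by auto
  ultimately show ?thesis using i that by blast
qed

text \<open>
  Two parallel factors both divide \<open>x\<^sup>e - 1\<close> for a common multiple \<open>e\<close> of their exponents, so
  in an annihilating product with as few factors as possible no two exponents are parallel.
\<close>

lemma Ann_pairwise_independent:
  fixes X :: "(int ^ 'd \<Rightarrow> int) set" and S :: "(real ^ 'd) set"
  assumes bound: "\<And>c u. c \<in> X \<Longrightarrow> \<bar>c u\<bar> \<le> B" and "subspace S"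
    and "finite T0" "T0 \<noteq> {}" "\<And>t. t \<in> T0 \<Longrightarrow> real_vec t \<notin> S"
    "(\<Prod>t\<in>T0. laurent_monom t - 1) \<in> Ann X"
  obtains T where "finite T" "T \<noteq> {}" "\<And>t. t \<in> T \<Longrightarrow> real_vec t \<notin> S"
    "(\<Prod>t\<in>T. laurent_monom t - 1) \<in> Ann X"
    "\<And>s t. s \<in> T \<Longrightarrow> t \<in> T \<Longrightarrow> s \<noteq> t \<Longrightarrow> lin_indep_pair s t"
proof -
  define P where "P T \<longleftrightarrow> finite T \<and> T \<noteq> {} \<and> (\<forall>t\<in>T. real_vec t \<notin> S) \<and>
    (\<Prod>t\<in>T. laurent_monom t - 1) \<in> Ann X" for T
  have "P T0" using assms by (simp add: P_def)
  then obtain T where T: "P T" and min: "\<And>T'. P T' \<Longrightarrow> card T \<le> card T'"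
    using ex_has_least_nat[of P T0 card] by blast
  have "lin_indep_pair s t" if st: "s \<in> T" "t \<in> T" "s \<noteq> t" for s t
  proof (rule ccontr)
    assume dep: "\<not> lin_indep_pair s t"
    have "s \<noteq> 0" "t \<noteq> 0"
      using T st subspace_0[OF \<open>subspace S\<close>] by (auto simp: P_def real_vec_0)
    then obtain m n :: int where mn: "of_int m * s = of_int n * t" "m \<noteq> 0" "n \<noteq> 0"
      using common_multiple_if_dependent[OF _ _ st(3) dep] by blast
    define e where "e = of_int m * s"
    have "real_vec e \<notin> S"
    proof
      assume "real_vec e \<in> S"
      then have "(1 / of_int m) *\<^sub>R real_vec e \<in> S" using \<open>subspace S\<close> by (simp add: subspace_scale)
      then show False using mn(2) T st by (simp add: P_def e_def real_vec_of_int_mult)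
    qed
    define R where "R = T - {s, t}"
    have fin: "finite R" "finite T" using T by (auto simp: R_def P_def)
    let ?h = "\<lambda>t. laurent_monom t - 1"
    have "prod ?h T = ?h s * (?h t * prod ?h R)"
    proof -
      have "T = insert s (insert t R)" using st by (auto simp: R_def)
      moreover have "s \<notin> insert t R" "t \<notin> R" using st by (auto simp: R_def)
      ultimately show ?thesis using fin by simp
    qed
    moreover have "?h s dvd ?h e"
      unfolding e_def by (rule laurent_monom_minus_1_dvd)
    moreover have "?h t dvd ?h e"
      unfolding e_def mn(1) by (rule laurent_monom_minus_1_dvd)
    ultimately have "prod ?h T dvd ?h e * ?h e * prod ?h R"
      by (simp only: mult.assoc mult_dvd_mono dvd_refl)
    then have "?h e * ?h e * prod ?h R \<in> Ann X"
      using T Ann_dvd unfolding P_def by blast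
    then have 1: "?h e * prod ?h R \<in> Ann X"
      by (rule Ann_monom_square_cancel[where B = B]) (rule bound)
    \<comment> \<open>If \<open>e\<close> already occurs in \<open>R\<close>, its factor appears
      twice, whereas a product over a set has it once; the square is then cancelled again.\<close>
    have "prod ?h (insert e R) \<in> Ann X"
    proof (cases "e \<in> R")
      case True
      have "prod ?h R = ?h e * prod ?h (R - {e})" using fin True by (simp add: prod.remove)
      then have "?h e * ?h e * prod ?h (R - {e}) \<in> Ann X" using 1 by (simp add: mult.assoc)
      then have "?h e * prod ?h (R - {e}) \<in> Ann X"
        by (rule Ann_monom_square_cancel[where B = B]) (rule bound)
      then show ?thesis using True fin by (simp add: insert_absorb prod.remove)
    qed (use 1 fin in simp)
    then have "P (insert e R)" using T \<open>real_vec e \<notin> S\<close> fin by (auto simp: P_def R_def)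
    then have "card T \<le> card (insert e R)" by (rule min)
    moreover have "card (insert e R) \<le> Suc (card R)" by (rule card_insert_le_m1) auto
    moreover have "card T = Suc (Suc (card R))"
    proof -
      have "T = insert s (insert t R)" using st by (auto simp: R_def)
      moreover have "s \<notin> insert t R" "t \<notin> R" using st by (auto simp: R_def)
      ultimately show ?thesis using fin by simp
    qed
    ultimately show False by simp
  qed
  with T show ?thesis unfolding P_def by (intro that[of T]) blast+
qed

subsection \<open>Expansive hyperplanes\<close>

text \<open>Splitting off one factor, the induction hypothesis shows that \<open>x^t - 1\<close>
  kills \<open>d\<close>, so \<open>t\<close> is a period. Being transversal to the boundary, it
  moves every point into the half-space where \<open>d\<close> vanishes. The bound \<open>b\<close>
  is arbitrary because it drops with each factor.\<close>

lemma eq_0_if_prod_monom_annihilates: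
  fixes d :: "int ^ 'd \<Rightarrow> complex"
  assumes "finite T" "\<And>t. t \<in> T \<Longrightarrow> real_vec t \<bullet> u \<noteq> 0"
    and "\<And>x. real_vec x \<bullet> u < b \<Longrightarrow> d x = 0"
    and "poly_act (\<Prod>t\<in>T. laurent_monom t - 1) d = (\<lambda>_. 0)"
  shows "d = (\<lambda>_. 0)"
  using assms
proof (induction T arbitrary: d b rule: finite_induct)
  case (insert t T)
  define d' where "d' = poly_act (laurent_monom t - 1) d"
  have d': "d' x = d (x - t) - d x" for x by (simp add: d'_def poly_act_monom_minus_1)
  have "d' = (\<lambda>_. 0)"
  proof (rule insert.IH)
    \<comment> \<open>The lowered bound places both \<open>x\<close> and \<open>x - t\<close> in the
      half-space where \<open>d\<close> vanishes.\<close>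
    show "d' x = 0" if "real_vec x \<bullet> u < b - \<bar>real_vec t \<bullet> u\<bar>" for x
      using that insert.prems(2)[of x] insert.prems(2)[of "x - t"]
      by (simp add: d' real_vec_diff inner_diff_left)
    show "poly_act (\<Prod>t\<in>T. laurent_monom t - 1) d' = (\<lambda>_. 0)"
      using insert.prems(3) insert.hyps
      by (simp add: d'_def mult.commute[of "laurent_monom t - 1"] flip: poly_act_mult)
  qed (use insert in auto)
  then have "d x = d (x + t)" for x
    using d'[of "x + t"] by simp
  then have "t \<in> period_lattice d" by (simp add: period_lattice_def)
  show ?case
  proof
    fix x
    define s where "s = real_vec t \<bullet> u"
    have "s \<noteq> 0" using insert.prems(1)[of t] by (simp add: s_def)
    obtain n :: nat where n: "real_vec x \<bullet> u - b < real n * \<bar>s\<bar>"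
      using reals_Archimedean3[of "\<bar>s\<bar>"] \<open>s \<noteq> 0\<close> by auto
    \<comment> \<open>The sign makes the shift by \<open>k\<close> periods decrease the inner
      product with \<open>u\<close>.\<close>
    define k where "k = (if s > 0 then - int n else int n)"
    have "real_vec (x + of_int k * t) \<bullet> u = real_vec x \<bullet> u - real n * \<bar>s\<bar>"
      by (simp add: real_vec_add real_vec_of_int_mult inner_add_left k_def flip: s_def)
    then have "d (x + of_int k * t) = 0" using n by (intro insert.prems(2)) simp
    then show "d x = 0"
      using period_lattice_of_int_mult[OF \<open>t \<in> period_lattice d\<close>, of k] by (simp add: period_lattice_def)
  qed
qed simp

text \<open>By linearity the product kills the difference of two configurations, and agreement on
  the half-space makes that difference vanish there.\<close>

lemma deterministic_if_prod_monom_in_Ann: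
  fixes X :: "(int ^ 'd \<Rightarrow> int) set"
  assumes "finite T" "\<And>t. t \<in> T \<Longrightarrow> real_vec t \<bullet> u \<noteq> 0"
    and "(\<Prod>t\<in>T. laurent_monom t - 1) \<in> Ann X"
  shows "deterministic X u"
  unfolding deterministic_def
proof (intro ballI impI)
  fix c c' assume c: "c \<in> X" "c' \<in> X" and eq: "\<forall>x\<in>lattice_halfspace u. c x = c' x"
  let ?d = "\<lambda>x. config_series c x - config_series c' x"
  let ?h = "\<Prod>t\<in>T. laurent_monom t - 1"
  have "poly_act ?h ?d = (\<lambda>_. 0)"
  proof
    fix x
    have "poly_act ?h ?d x = poly_act ?h (config_series c) x - poly_act ?h (config_series c') x"
      by (simp add: poly_act_def right_diff_distrib sum_subtractf)
    then show "poly_act ?h ?d x = 0" using assms(3) c by (simp add: in_Ann_iff)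
  qed
  moreover have "?d x = 0" if "real_vec x \<bullet> u < 0" for x
    using eq that by (simp add: lattice_halfspace_def config_series_def)
  ultimately have "?d = (\<lambda>_. 0)"
    using eq_0_if_prod_monom_annihilates[OF assms(1,2), where d = ?d and b = 0] by blast
  then show "c = c'" by (simp add: fun_eq_iff config_series_def)
qed

lemma hyperplane_normal_vector:
  fixes S :: "(real ^ 'd) set"
  assumes "subspace S" "dim S = CARD('d) - 1"
  obtains u where "u \<noteq> 0" "S = {v. u \<bullet> v = 0}"
proof -
  have "CARD('d) > 0" by simp
  then have "dim S < DIM(real ^ 'd)" using assms(2) by simp
  then obtain u where u: "u \<noteq> 0" "span S \<subseteq> {v. u \<bullet> v = 0}"
    using lowdim_subset_hyperplane by blast
  have "S = {v. u \<bullet> v = 0}"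
  proof (rule subspace_dim_equal)
    show "S \<subseteq> {v. u \<bullet> v = 0}" using u(2) span_superset by blast
    show "dim {v. u \<bullet> v = 0} \<le> dim S"
      using dim_hyperplane[OF u(1)] assms(2) by simp
  qed (use assms subspace_hyperplane in auto)
  with u(1) show ?thesis by (rule that)
qed

section \<open>Assembly of the annihilating product and expansiveness\<close>

theorem theorem3:
  fixes A :: "int set"
    and X :: "(int ^ 'd \<Rightarrow> int) set"
    and S :: "(real ^ 'd) set"
    and f :: "'d laurent"
  assumes "finite A"
    and "subshift A X"
    and "subspace S" and "S \<noteq> UNIV"
    and "f \<in> Per X"
    and "real_vec ` Poly_Mapping.keys f \<inter> S = {0}"
  shows "(\<exists>(m::nat) (t :: nat \<Rightarrow> int ^ 'd).
            m \<ge> 1 \<and>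
            (\<forall>i\<in>{1..m}. \<forall>j\<in>{1..m}. i \<noteq> j \<longrightarrow> lin_indep_pair (t i) (t j)) \<and>
            (\<forall>i\<in>{1..m}. real_vec (t i) \<notin> S) \<and>
            (\<Prod>i=1..m. laurent_monom (t i) - 1) \<in> Ann X) \<and>
         (dim S = CARD('d) - 1 \<longrightarrow> expansive_space X S)"
proof -
  \<comment> \<open>A sum instead of a maximum spares a separate case for the empty
    alphabet.\<close>
  have bound: "\<bar>c u\<bar> \<le> (\<Sum>a\<in>A. \<bar>a\<bar>)" if "c \<in> X" for c u
    using subshift_range[OF assms(2) that] assms(1) by (intro member_le_sum) auto
  obtain g where g: "g \<in> Ann X" "real_vec ` Poly_Mapping.keys g \<inter> S = {0}"
    using Per_imp_Ann[OF assms] by blast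
  define V where "V = Poly_Mapping.keys g"
  have "0 \<in> V"
  proof -
    have "0 \<in> real_vec ` V" using g(2) by (auto simp: V_def)
    then show ?thesis by (metis imageE real_vec_eq_0_iff)
  qed
  have V_notin: "real_vec v \<notin> S" if "v \<in> V - {0}" for v
  proof
    assume "real_vec v \<in> S"
    then have "real_vec v \<in> real_vec ` Poly_Mapping.keys g \<inter> S" using that by (auto simp: V_def)
    then have "real_vec v = 0" using g(2) by simp
    then show False using that by (simp add: real_vec_eq_0_iff)
  qed
  obtain a :: "int ^ 'd \<Rightarrow> int" where a: "a 0 \<noteq> 0"
    "\<And>c u. c \<in> X \<Longrightarrow> (\<Sum>v\<in>V. a v * c (u - v)) = 0"
    by (rule Ann_imp_integer_relation[OF g(1) \<open>0 \<in> V\<close>[unfolded V_def], folded V_def]) (rule that)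
  obtain r :: nat where r: "r > 0" "(\<Prod>v\<in>V - {0}. laurent_monom (of_nat r * v) - 1) \<in> Ann X"
    by (rule Ann_prod_monom[where V = V and a = a and X = X])
      (use a bound \<open>0 \<in> V\<close> in \<open>auto simp: V_def\<close>)
  define W where "W = (\<lambda>v. of_nat r * v) ` (V - {0})"
  have "inj_on (\<lambda>v::int ^ 'd. of_nat r * v) (V - {0})"
    using r(1) by (auto simp: inj_on_def vec_eq_iff of_nat_index)
  then have W: "(\<Prod>t\<in>W. laurent_monom t - 1) \<in> Ann X"
    using r(2) by (simp add: W_def prod.reindex)
  have W_notin: "real_vec t \<notin> S" if "t \<in> W" for t
  proof
    assume "real_vec t \<in> S"
    obtain v where v: "v \<in> V - {0}" "t = of_nat r * v" using \<open>t \<in> W\<close> unfolding W_def by blast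
    have "(1 / real r) *\<^sub>R real_vec t \<in> S" using \<open>real_vec t \<in> S\<close> assms(3) by (simp add: subspace_scale)
    then show False using V_notin[OF v(1)] r(1) by (simp add: v(2) real_vec_of_nat_mult)
  qed
  have "finite W" by (simp add: W_def V_def)
  \<comment> \<open>\<open>W\<close> is empty when \<open>V = {0}\<close>. An extra factor with
    exponent outside \<open>S\<close> keeps the product in \<open>Ann X\<close> and ensures at least
    one factor.\<close>
  obtain w :: "int ^ 'd" where w: "real_vec w \<notin> S"
    using exists_lattice_vector_notin_subspace[OF assms(3,4)] by blast
  have wW: "(\<Prod>t\<in>insert w W. laurent_monom t - 1) \<in> Ann X"
    using \<open>finite W\<close> by (intro Ann_dvd[OF W] prod_dvd_prod_subset) auto
  obtain T where T: "finite T" "T \<noteq> {}" "\<And>t. t \<in> T \<Longrightarrow> real_vec t \<notin> S"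
    "(\<Prod>t\<in>T. laurent_monom t - 1) \<in> Ann X"
    "\<And>s t. s \<in> T \<Longrightarrow> t \<in> T \<Longrightarrow> s \<noteq> t \<Longrightarrow> lin_indep_pair s t"
  proof (rule Ann_pairwise_independent[where X = X and S = S and ?T0.0 = "insert w W"])
    show "\<bar>c u\<bar> \<le> (\<Sum>a\<in>A. \<bar>a\<bar>)" if "c \<in> X" for c u by (rule bound[OF that])
    show "real_vec t \<notin> S" if "t \<in> insert w W" for t using that w W_notin by blast
    show "subspace S" by (rule assms(3))
    show "finite (insert w W)" using \<open>finite W\<close> by simp
    show "insert w W \<noteq> {}" by simp
    show "(\<Prod>t\<in>insert w W. laurent_monom t - 1) \<in> Ann X" by (rule wW)
  qed (rule that)
  obtain t where t: "bij_betw t {1..card T} T"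
    using ex_bij_betw_nat_finite_1[OF T(1)] by blast
  have tT: "t i \<in> T" if "i \<in> {1..card T}" for i using t that by (rule bij_betwE[rule_format])
  have "(\<Prod>i=1..card T. laurent_monom (t i) - 1) \<in> Ann X"
    using T(4) prod.reindex_bij_betw[OF t, of "\<lambda>t. laurent_monom t - 1"] by simp
  moreover have "card T \<ge> 1" using T(1,2) by (simp add: Suc_le_eq card_gt_0_iff)
  moreover have "lin_indep_pair (t i) (t j)" if "i \<in> {1..card T}" "j \<in> {1..card T}" "i \<noteq> j" for i j
    using that tT T(5) bij_betw_imp_inj_on[OF t] by (meson inj_onD)
  moreover have "expansive_space X S" if dim: "dim S = CARD('d) - 1"
  proof -
    obtain u where u: "u \<noteq> 0" "S = {v. u \<bullet> v = 0}"
      using hyperplane_normal_vector[OF assms(3) dim] by blast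
    have "real_vec t \<bullet> u \<noteq> 0" if "t \<in> T" for t
      using T(3)[OF that] u(2) by (simp add: inner_commute)
    \<comment> \<open>Having nonzero inner product with the normal is insensitive to its sign, so
      one set \<open>T\<close> serves both directions.\<close>
    then have "deterministic X u" "deterministic X (- u)"
      using T(1,4) by (auto intro!: deterministic_if_prod_monom_in_Ann[of T])
    then show ?thesis using u unfolding expansive_space_def by blast
  qed
  moreover have "real_vec (t i) \<notin> S" if "i \<in> {1..card T}" for i
    using tT[OF that] by (rule T(3))
  ultimately show ?thesis
    by (intro conjI exI[of _ "card T"] exI[of _ t] ballI impI)
qed

end
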